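(* Let $A,B\subset\mathbb{R}^m$ be closed sets in the smooth transverse setting (see context), such that $M:=A\cap B$ is compact, and suppose: (i) for some $\theta_0>0$, $\angle(T_xA,T_xB)\in[\theta_0,\pi/2]$ for all $x\in M$; (ii) $A$ and $B$ have reach $\ge\rho>0$ and second fundamental forms bounded by $\kappa<\infty$. For $0<r\le\rho$ let $\mathcal S_r:=\{x\in\mathbb{R}^m:\ \mathrm{dist}(x,A)\le r,\ \mathrm{dist}(R_Ax,B)\le r\}$. Then there exist $r\in(0,\rho]$ and $\sigma>0$ such that for every solution $x(\cdot)$ of $\dot x=v(x)$ with $x(t)\in\mathcal S_r$, $$\frac{d}{dt}\Bigl(\tfrac12\|v(x(t))\|^2\Bigr)\le-\sigma\|v(x(t))\|^2 .$$ Consequently (for such solutions), $\|v(x(t))\|\to0$ exponentially and $\mathrm{dist}(x(t),M)\to0$ as $t\to\infty$.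
   Context: For closed sets $A,B\subset\mathbb{R}^m$ let $P_A,P_B$ be the metric (nearest-point) projections, $R_A:=2P_A-\mathrm{Id}$, and $v(x):=P_B(R_Ax)-P_Ax$ (the RRR flow field). Smooth transverse setting: $A$ and $B$ are $C^2$ embedded submanifolds of $\mathbb{R}^m$ that intersect transversally at points $x^*\in A\cap B$. In a sufficiently small neighborhood of such a point the projections $P_A$ and $P_B$ are single-valued and $C^1$, and their derivatives at $x^*$ are the orthogonal projectors onto $T_{x^*}A$, $T_{x^*}B$. The intersection $M:=A\cap B$ is then a $C^2$ submanifold, and $P_A,P_B$ restrict to the identity on $M$ near $x^*$. $\angle(T_xA,T_xB)$ refers to the nonzero principal angles between the tangent spaces, i.e. the principal angles other than those coming from the common subspace $T_xA\cap T_xB$; condition (i) requires all of them to lie in $[\theta_0,\pi/2]$. The reach of a closed set $S$ is the supremum of $s\ge 0$ such that every point at distance less than $s$ from $S$ has a unique nearest point in $S$.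
   Formalization: The formal theorem also assumes that {a in A : dist(a,B) ≤ s} is bounded for some s>0; without it the claim fails, e.g. for A the axis y=0 and B the graph of s/(1+s²) in the plane. *)

theory Defs
  imports "HOL-Analysis.Analysis"
begin

definition C2_on :: "('a::real_normed_vector \<Rightarrow> 'b::real_normed_vector) \<Rightarrow> 'a set \<Rightarrow> bool"
  where "C2_on f U \<longleftrightarrow>
    (\<exists>(f' :: 'a \<Rightarrow> 'a \<Rightarrow>\<^sub>L 'b) (f'' :: 'a \<Rightarrow> 'a \<Rightarrow>\<^sub>L ('a \<Rightarrow>\<^sub>L 'b)).
       (\<forall>x\<in>U. (f has_derivative blinfun_apply (f' x)) (at x)) \<and>
       (\<forall>x\<in>U. (f' has_derivative blinfun_apply (f'' x)) (at x)) \<and>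
       continuous_on U f'')"

(* C^2 embedded submanifold of dimension k, via slice charts (without boundary). *)
definition C2_submanifold :: "nat \<Rightarrow> 'a::euclidean_space set \<Rightarrow> bool"
  where "C2_submanifold k S \<longleftrightarrow>
    (\<forall>p\<in>S. \<exists>U V (\<phi> :: 'a \<Rightarrow> 'a) \<psi> L.
       open U \<and> p \<in> U \<and> open V \<and> homeomorphism U V \<phi> \<psi> \<and>
       C2_on \<phi> U \<and> C2_on \<psi> V \<and>
       subspace L \<and> dim L = k \<and> \<phi> ` (S \<inter> U) = L \<inter> V)"

(* Velocities of curves in S through x.  Differentiability of the curve at 0 is enough:
   for a C^2 submanifold one obtains the same space as with C^1 curves. *)
definition tangent_space :: "'a::euclidean_space set \<Rightarrow> 'a \<Rightarrow> 'a set"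
  where "tangent_space S x =
    {u. \<exists>\<gamma> :: real \<Rightarrow> 'a. \<gamma> 0 = x \<and> (\<forall>\<^sub>F t in nhds 0. \<gamma> t \<in> S) \<and>
         (\<gamma> has_vector_derivative u) (at 0)}"

definition transverse :: "'a::euclidean_space set \<Rightarrow> 'a set \<Rightarrow> bool"
  where "transverse A B \<longleftrightarrow>
    (\<forall>x\<in>A \<inter> B. {a + b |a b. a \<in> tangent_space A x \<and> b \<in> tangent_space B x} = UNIV)"

(* Gauss formula: the value at (u, w) is the normal component of W'(0), where W is a
   tangent vector field along a curve in S with velocity u at x, and W(0) = w.
   On a C^2 submanifold this does not depend on the curve or on W. *)
definition second_fundamental_form ::
    "'a::euclidean_space set \<Rightarrow> 'a \<Rightarrow> 'a \<Rightarrow> 'a \<Rightarrow> 'a"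
  where "second_fundamental_form S x u w =
    (THE n. \<exists>(\<gamma> :: real \<Rightarrow> 'a) (W :: real \<Rightarrow> 'a) D.
       \<gamma> 0 = x \<and> W 0 = w \<and>
       (\<forall>\<^sub>F t in nhds 0. \<gamma> t \<in> S \<and> W t \<in> tangent_space S (\<gamma> t)) \<and>
       (\<gamma> has_vector_derivative u) (at 0) \<and> (W has_vector_derivative D) (at 0) \<and>
       (\<forall>y\<in>tangent_space S x. n \<bullet> y = 0) \<and> D - n \<in> tangent_space S x)"

definition second_fundamental_form_bounded :: "'a::euclidean_space set \<Rightarrow> real \<Rightarrow> bool"
  where "second_fundamental_form_bounded S \<kappa> \<longleftrightarrow>
    (\<forall>x\<in>S. \<forall>u\<in>tangent_space S x. \<forall>w\<in>tangent_space S x.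
       norm (second_fundamental_form S x u w) \<le> \<kappa> * norm u * norm w)"

(* Extended-real valued, since the reach of e.g. an affine subspace is infinite. *)
definition reach :: "'a::euclidean_space set \<Rightarrow> ereal"
  where "reach S =
    Sup {ereal s |s. 0 \<le> s \<and> (\<forall>x. infdist x S < s \<longrightarrow> (\<exists>!y. y \<in> S \<and> dist x y = infdist x S))}"

(* Principal vectors in the usual recursive sense: (u i, v i) maximises the inner product over
   the unit vectors of E and F orthogonal to the earlier u j and v j, respectively. *)
definition principal_candidates ::
    "'a::euclidean_space set \<Rightarrow> 'a set \<Rightarrow> (nat \<Rightarrow> 'a) \<Rightarrow> (nat \<Rightarrow> 'a) \<Rightarrow> nat \<Rightarrow> ('a \<times> 'a) set"
  where "principal_candidates E F u v i =
    {(y, z). y \<in> E \<and> z \<in> F \<and> norm y = 1 \<and> norm z = 1 \<and>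
             (\<forall>j<i. y \<bullet> u j = 0 \<and> z \<bullet> v j = 0)}"

definition principal_vectors ::
    "'a::euclidean_space set \<Rightarrow> 'a set \<Rightarrow> (nat \<Rightarrow> 'a) \<Rightarrow> (nat \<Rightarrow> 'a) \<Rightarrow> bool"
  where "principal_vectors E F u v \<longleftrightarrow>
    (\<forall>i < min (dim E) (dim F).
       (u i, v i) \<in> principal_candidates E F u v i \<and>
       (\<forall>(y, z)\<in>principal_candidates E F u v i. y \<bullet> z \<le> u i \<bullet> v i))"

definition principal_angles :: "'a::euclidean_space set \<Rightarrow> 'a set \<Rightarrow> real set"
  where "principal_angles E F =
    {arccos (u i \<bullet> v i) |u v i. principal_vectors E F u v \<and> i < min (dim E) (dim F)}"

(* For a closed nonempty set the library's closest_point is a nearest-point selection; it is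
   the metric projection wherever the nearest point is unique. *)
definition reflection :: "'a::euclidean_space set \<Rightarrow> 'a \<Rightarrow> 'a"
  where "reflection A x = 2 *\<^sub>R closest_point A x - x"

definition rrr_field :: "'a::euclidean_space set \<Rightarrow> 'a set \<Rightarrow> 'a \<Rightarrow> 'a"
  where "rrr_field A B x = closest_point B (reflection A x) - closest_point A x"

definition rrr_tube :: "'a::euclidean_space set \<Rightarrow> 'a set \<Rightarrow> real \<Rightarrow> 'a set"
  where "rrr_tube A B r = {x. infdist x A \<le> r \<and> infdist (reflection A x) B \<le> r}"

definition rrr_solution ::
    "'a::euclidean_space set \<Rightarrow> 'a set \<Rightarrow> real set \<Rightarrow> (real \<Rightarrow> 'a) \<Rightarrow> bool"
  where "rrr_solution A B I x \<longleftrightarrow>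
    (\<forall>t\<in>I. (x has_vector_derivative rrr_field A B (x t)) (at t within I))"

(* Compactness of the intersection does not prevent A and B from approaching each other at
   infinity: for A the axis y = 0 and B the graph of s / (1 + s^2) in the plane, the tube is
   unbounded for every r > 0 and no uniform decay rate exists on it.  Excluding this is necessary
   for a uniform rate, and it is automatic if A or B is compact. *)
definition separated_at_infinity :: "'a::euclidean_space set \<Rightarrow> 'a set \<Rightarrow> bool"
  where "separated_at_infinity A B \<longleftrightarrow> (\<exists>s>0. bounded {a \<in> A. infdist a B \<le> s})"

end

theory Submission
  imports Defs "HOL-Real_Asymp.Real_Asymp"
begin

text \<open>Let \<open>a = P\<^sub>A x\<close>, \<open>y = R\<^sub>A x\<close> and \<open>b = P\<^sub>B y\<close>. Then \<open>v(x) = (a - x) + (b - y)\<close> is the sum of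
  a vector normal to \<open>A\<close> at \<open>a\<close> and one normal to \<open>B\<close> at \<open>b\<close>. At a point of \<open>A \<inter> B\<close> with tangent
  spaces \<open>E\<close> and \<open>F\<close> the derivative of the field is \<open>T = P\<^sub>F (2 P\<^sub>E - Id) - P\<^sub>E\<close>, which satisfies
  \<open>v \<bullet> T v = - \<parallel>P\<^sub>F v - P\<^sub>E v\<parallel>\<^sup>2\<close>. If \<open>v = p + q\<close> with \<open>p\<close> orthogonal to \<open>E\<close> and \<open>q\<close> orthogonal to
  \<open>F\<close>, then \<open>P\<^sub>F v - P\<^sub>E v = P\<^sub>F p - P\<^sub>E q\<close>, and by transversality this is bounded below by a multiple
  of \<open>\<parallel>p\<parallel> + \<parallel>q\<parallel>\<close>. Since the projections are \<open>C\<^sup>1\<close> near \<open>A \<inter> B\<close>, both facts persist up to small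
  errors, and compactness makes the decay rate uniform.\<close>

section \<open>Projections onto subspaces and closed sets\<close>

lemma closest_point_subspace:
  fixes E :: "'a::euclidean_space set"
  assumes "subspace E"
  shows "closest_point E x \<in> E" and "z \<in> E \<Longrightarrow> (x - closest_point E x) \<bullet> z = 0"
proof -
  obtain y w where y: "y \<in> span E" and w: "\<And>u. u \<in> span E \<Longrightarrow> orthogonal w u" and x: "x = y + w"
    using orthogonal_subspace_decomp_exists by blast
  have sp: "span E = E"
    using assms by (simp add: span_eq_iff)
  have "dist x y \<le> dist x u" if "u \<in> E" for u
  proof -
    have "w \<bullet> (y - u) = 0"
      using w[of "y - u"] y that assms sp by (auto simp: orthogonal_def subspace_diff)
    then have "(norm (w + (y - u)))\<^sup>2 = (norm w)\<^sup>2 + (norm (y - u))\<^sup>2"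
      by (simp add: power2_norm_eq_inner inner_add inner_commute)
    then have "norm w \<le> norm (w + (y - u))"
      by (metis le_add_same_cancel1 norm_ge_zero power2_le_imp_le zero_le_power2)
    then show ?thesis
      by (simp add: x dist_norm algebra_simps)
  qed
  then have "y = closest_point E x"
    using y sp assms closed_subspace subspace_imp_convex by (intro closest_point_unique) auto
  then show "closest_point E x \<in> E" "z \<in> E \<Longrightarrow> (x - closest_point E x) \<bullet> z = 0"
    using y w[of z] sp x by (auto simp: orthogonal_def)
qed

lemma closest_point_subspace_eqI:
  fixes E :: "'a::euclidean_space set"
  assumes "subspace E" "y \<in> E" "\<And>z. z \<in> E \<Longrightarrow> (x - y) \<bullet> z = 0"
  shows "closest_point E x = y"
proof -
  let ?d = "closest_point E x - y"
  have d: "?d \<in> E"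
    using assms closest_point_subspace(1) subspace_diff by blast
  have "?d \<bullet> ?d = (x - y) \<bullet> ?d - (x - closest_point E x) \<bullet> ?d"
    by (simp add: inner_diff)
  also have "\<dots> = 0"
    using assms d closest_point_subspace(2) by fastforce
  finally show ?thesis
    by simp
qed

lemma linear_closest_point_subspace:
  fixes E :: "'a::euclidean_space set"
  assumes E: "subspace E"
  shows "linear (closest_point E)"
proof (rule linearI)
  fix x y and c :: real
  show "closest_point E (x + y) = closest_point E x + closest_point E y"
  proof (rule closest_point_subspace_eqI[OF E])
    show "closest_point E x + closest_point E y \<in> E"
      by (intro subspace_add closest_point_subspace E)
    show "(x + y - (closest_point E x + closest_point E y)) \<bullet> z = 0" if "z \<in> E" for z
      using closest_point_subspace(2)[OF E that, of x] closest_point_subspace(2)[OF E that, of y]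
      by (simp add: inner_diff inner_add)
  qed
  show "closest_point E (c *\<^sub>R x) = c *\<^sub>R closest_point E x"
  proof (rule closest_point_subspace_eqI[OF E])
    show "c *\<^sub>R closest_point E x \<in> E"
      by (intro subspace_scale closest_point_subspace E)
    show "(c *\<^sub>R x - c *\<^sub>R closest_point E x) \<bullet> z = 0" if "z \<in> E" for z
      using closest_point_subspace(2)[OF E that, of x]
      by (simp flip: scaleR_right_diff_distrib)
  qed
qed

lemma inner_closest_point_subspace:
  fixes E :: "'a::euclidean_space set"
  assumes "subspace E"
  shows "x \<bullet> closest_point E x = (norm (closest_point E x))\<^sup>2"
  using closest_point_subspace(2)[OF assms closest_point_subspace(1)[OF assms], of x x]
  by (simp add: power2_norm_eq_inner inner_diff_left)

lemma norm_closest_point_subspace_le: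
  fixes E :: "'a::euclidean_space set"
  assumes "subspace E"
  shows "norm (closest_point E x) \<le> norm x"
proof -
  have "(norm (closest_point E x))\<^sup>2 \<le> norm x * norm (closest_point E x)"
    using Cauchy_Schwarz_ineq2[of x "closest_point E x"] inner_closest_point_subspace[OF assms, of x]
    by linarith
  then show ?thesis
    by (auto simp: power2_eq_square mult_le_cancel_right)
qed

section \<open>Nearest points in closed sets of positive reach\<close>

lemma reach_unique_closest_point:
  assumes "ereal \<rho> \<le> reach S" "infdist x S < \<rho>"
  shows "\<exists>!y. y \<in> S \<and> dist x y = infdist x S"
proof -
  have "ereal (infdist x S) < reach S"
    using assms by (metis less_ereal.simps(1) less_le_trans)
  then show ?thesis
    unfolding reach_def less_Sup_iff by auto
qed

lemma dist_closest_point_eq_infdist: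
  assumes "closed S" "S \<noteq> {}"
  shows "dist x (closest_point S x) = infdist x S"
  using assms by (simp add: closest_point_exists infdist_eq_setdist setdist_closest_point)

text \<open>Compactness and uniqueness: nearest points along a convergent sequence stay bounded, and
  every limit of them is a nearest point of the limit \<open>x\<close>. Below the reach there is
  only one such point, so the choice made by \<open>closest_point\<close> cannot jump.\<close>

lemma isCont_closest_point_reach:
  fixes S :: "'a::euclidean_space set"
  assumes S: "closed S" "S \<noteq> {}" and reach: "ereal \<rho> \<le> reach S" and x: "infdist x S < \<rho>"
  shows "isCont (closest_point S) x"
proof (rule ccontr)
  assume "\<not> isCont (closest_point S) x"
  then obtain u where u: "u \<longlonglongrightarrow> x" and nu: "\<not> (\<lambda>n. closest_point S (u n)) \<longlonglongrightarrow> closest_point S x"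
    unfolding continuous_at_sequentially comp_def by blast
  then obtain e where e: "e > 0" and "\<exists>\<^sub>F n in sequentially. \<not> dist (closest_point S (u n)) (closest_point S x) < e"
    unfolding tendsto_iff by (auto simp: frequently_def)
  then obtain s :: "nat \<Rightarrow> nat" where s: "strict_mono s" 
    and far: "\<And>n. \<not> dist (closest_point S (u (s n))) (closest_point S x) < e"
    using infinite_enumerate[of "{n. \<not> dist (closest_point S (u n)) (closest_point S x) < e}"]
    by (auto simp: cofinite_eq_sequentially[symmetric] frequently_cofinite)
  have us: "(u \<circ> s) \<longlonglongrightarrow> x"
    using LIMSEQ_subseq_LIMSEQ[OF u s] .
  \<comment> \<open>Comparison with the fixed competitor \<open>closest_point S 0\<close> bounds the
    distance of \<open>u (s n)\<close> from its nearest point.\<close>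
  have "bounded (range (\<lambda>n. closest_point S (u (s n))))"
  proof -
    obtain b where b: "\<And>n. norm (u (s n)) \<le> b"
      using convergent_imp_bounded[OF us] by (auto simp: bounded_iff)
    have "norm (closest_point S (u (s n))) \<le> norm (closest_point S 0) + 2 * b" for n
    proof -
      have "dist (u (s n)) (closest_point S (u (s n))) \<le> dist (u (s n)) (closest_point S 0)"
        using S by (simp add: closest_point_le closest_point_in_set)
      then show ?thesis
        using b[of n] norm_triangle_ineq4[of "u (s n)" "closest_point S 0"] 
          norm_triangle_ineq2[of "closest_point S (u (s n))" "u (s n)"]
        by (simp add: dist_norm norm_minus_commute)
    qed
    then show ?thesis
      by (auto simp: bounded_iff)
  qed
  then obtain l and q :: "nat \<Rightarrow> nat" where q: "strict_mono q" 
    and l: "((\<lambda>n. closest_point S (u (s n))) \<circ> q) \<longlonglongrightarrow> l"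
    using bounded_imp_convergent_subsequence by blast
  have "l \<in> S"
    using closed_sequentially[OF S(1) _ l] S by (auto simp: closest_point_in_set)
  moreover have "dist x l = infdist x S"
  proof (rule LIMSEQ_unique)
    have usq: "(\<lambda>n. u (s (q n))) \<longlonglongrightarrow> x"
      using LIMSEQ_subseq_LIMSEQ[OF us q] by (simp add: comp_def)
    show "(\<lambda>n. infdist (u (s (q n))) S) \<longlonglongrightarrow> infdist x S"
      by (intro tendsto_infdist usq)
    have "(\<lambda>n. dist (u (s (q n))) (closest_point S (u (s (q n))))) \<longlonglongrightarrow> dist x l"
      using l by (intro tendsto_dist usq) (simp add: comp_def)
    then show "(\<lambda>n. infdist (u (s (q n))) S) \<longlonglongrightarrow> dist x l"
      using S by (simp add: dist_closest_point_eq_infdist)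
  qed
  ultimately have "l = closest_point S x"
    using reach_unique_closest_point[OF reach x] S
    by (metis closest_point_in_set dist_closest_point_eq_infdist)
  moreover have "\<forall>\<^sub>F n in sequentially. dist (closest_point S (u (s (q n)))) l < e"
    using tendstoD[OF l e] by (simp add: comp_def)
  ultimately show False
    using far by auto
qed

text \<open>First-order optimality: along a curve in \<open>S\<close> through the nearest point the
  squared distance to \<open>x\<close> has a local minimum at parameter 0. Only the derivative at 0
  enters, which matches the definition of \<open>tangent_space\<close>.\<close>

lemma orthogonal_tangent_space_closest_point:
  fixes S :: "'a::euclidean_space set"
  assumes S: "closed S" and u: "u \<in> tangent_space S (closest_point S x)"
  shows "(x - closest_point S x) \<bullet> u = 0"
proof -
  define a where "a = closest_point S x"
  obtain \<gamma> :: "real \<Rightarrow> 'a" where \<gamma>: "\<gamma> 0 = a" "\<forall>\<^sub>F t in nhds 0. \<gamma> t \<in> S" 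
    "(\<gamma> has_vector_derivative u) (at 0)"
    using u by (auto simp: tangent_space_def a_def)
  obtain d where d: "d > 0" "\<And>t. \<bar>t\<bar> < d \<Longrightarrow> \<gamma> t \<in> S"
    using \<gamma>(2) by (auto simp: eventually_nhds_metric dist_real_def)
  let ?f = "\<lambda>t. (x - \<gamma> t) \<bullet> (x - \<gamma> t)"
  have "(?f has_real_derivative - 2 * ((x - a) \<bullet> u)) (at 0)"
    using \<gamma>(3) unfolding has_vector_derivative_def has_field_derivative_def
    by (auto intro!: derivative_eq_intros simp: \<gamma>(1) fun_eq_iff inner_commute)
  moreover have "?f 0 \<le> ?f t" if "\<bar>0 - t\<bar> < d" for t
  proof -
    have "dist x a \<le> dist x (\<gamma> t)"
      using d(2)[of t] that S by (simp add: a_def closest_point_le)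
    then show ?thesis
      by (simp add: \<gamma>(1) dist_norm norm_le)
  qed
  ultimately have "- 2 * ((x - a) \<bullet> u) = 0"
    using DERIV_local_min d(1) by blast
  then show ?thesis
    by (simp add: a_def)
qed

section \<open>Slice charts\<close>

lemma norm_diff_closest_point_subspace_le:
  fixes E :: "'a::euclidean_space set"
  assumes "subspace E"
  shows "norm (x - closest_point E x) \<le> norm x"
proof -
  have "dist x (closest_point E x) \<le> dist x 0"
    using assms by (intro closest_point_le closed_subspace subspace_0)
  then show ?thesis
    by (simp add: dist_norm)
qed

lemma bounded_linear_closest_point_subspace:
  fixes E :: "'a::euclidean_space set"
  assumes "subspace E"
  shows "bounded_linear (closest_point E)"
  using linear_closest_point_subspace[OF assms] by (simp add: linear_conv_bounded_linear)

section \<open>Adjoints of bounded linear maps\<close>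

definition blinfun_adjoint :: "('a::euclidean_space \<Rightarrow>\<^sub>L 'a) \<Rightarrow> 'a \<Rightarrow> 'a"
  where "blinfun_adjoint T n = (\<Sum>i\<in>Basis. (blinfun_apply T i \<bullet> n) *\<^sub>R i)"

lemma inner_blinfun_adjoint: "blinfun_adjoint T n \<bullet> h = n \<bullet> blinfun_apply T h"
proof -
  have "blinfun_adjoint T n \<bullet> h = (\<Sum>i\<in>Basis. (h \<bullet> i) *\<^sub>R blinfun_apply T i) \<bullet> n"
    by (simp add: blinfun_adjoint_def inner_sum_left inner_sum_right inner_commute mult.commute)
  also have "(\<Sum>i\<in>Basis. (h \<bullet> i) *\<^sub>R blinfun_apply T i) = blinfun_apply T h"
    by (simp flip: blinfun.scaleR_right blinfun.sum_right add: euclidean_representation)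
  finally show ?thesis
    by (simp add: inner_commute)
qed

text \<open>The adjoint vector is tested against itself, which turns its squared norm into a pairing
  of \<open>n\<close> with an image under \<open>T\<close>.\<close>

lemma norm_blinfun_adjoint_le:
  fixes T :: "'a::euclidean_space \<Rightarrow>\<^sub>L 'a"
  shows "norm (blinfun_adjoint T n) \<le> norm T * norm n"
proof -
  let ?y = "blinfun_adjoint T n"
  have "(norm ?y)\<^sup>2 = n \<bullet> blinfun_apply T ?y"
    by (simp add: power2_norm_eq_inner inner_blinfun_adjoint)
  also have "\<dots> \<le> norm n * norm (blinfun_apply T ?y)"
    by (rule norm_cauchy_schwarz)
  also have "\<dots> \<le> norm n * (norm T * norm ?y)"
    by (intro mult_left_mono norm_blinfun) auto
  finally have "norm ?y * norm ?y \<le> (norm T * norm n) * norm ?y"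
    by (simp add: power2_eq_square algebra_simps)
  then show ?thesis
    by (cases "norm ?y = 0") (auto simp: mult_le_cancel_right)
qed

lemma linear_blinfun_adjoint: "linear (blinfun_adjoint T)"
  by (rule linearI)
    (auto simp: blinfun_adjoint_def inner_add scaleR_add_left sum.distrib scaleR_sum_right)

lemma blinfun_adjoint_diff_left: "blinfun_adjoint (T - T') n = blinfun_adjoint T n - blinfun_adjoint T' n"
  by (simp add: blinfun_adjoint_def blinfun.diff_left inner_diff_left scaleR_diff_left sum_subtractf)

lemma bounded_linear_blinfun_adjoint_left: "bounded_linear (\<lambda>T. blinfun_adjoint T n)"
  unfolding blinfun_adjoint_def
  by (intro bounded_linear_sum bounded_linear_scaleR_const bounded_linear_inner_left_comp
        blinfun.bounded_linear_left)

text \<open>Bilinearity supplies the product rule when both the operator and the vector vary, as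
  they do in \<open>normal_chart\<close>.\<close>

lemma bounded_bilinear_blinfun_adjoint:
  "bounded_bilinear (blinfun_adjoint :: ('a::euclidean_space \<Rightarrow>\<^sub>L 'a) \<Rightarrow> 'a \<Rightarrow> 'a)"
proof
  fix T T' :: "'a \<Rightarrow>\<^sub>L 'a" and n n' :: 'a and r :: real
  show "blinfun_adjoint (T + T') n = blinfun_adjoint T n + blinfun_adjoint T' n"
    "blinfun_adjoint (r *\<^sub>R T) n = r *\<^sub>R blinfun_adjoint T n"
    using bounded_linear_blinfun_adjoint_left by (auto dest: linear_simps)
  show "blinfun_adjoint T (n + n') = blinfun_adjoint T n + blinfun_adjoint T n'"
    "blinfun_adjoint T (r *\<^sub>R n) = r *\<^sub>R blinfun_adjoint T n"
    by (simp_all add: linear_add[OF linear_blinfun_adjoint] linear_scale[OF linear_blinfun_adjoint])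
  show "\<exists>K. \<forall>T n. norm (blinfun_adjoint T n :: 'a) \<le> norm T * norm n * K"
    by (rule exI[of _ 1]) (simp add: norm_blinfun_adjoint_le)
qed

text \<open>One flattening chart with its derivatives as explicit functions. The second derivative
  of \<phi> is recorded because \<open>normal_chart\<close> contains \<open>\<phi>'\<close> and is
  itself differentiated; \<psi> enters as a C^1 map.\<close>

locale slice_chart =
  fixes S U V L :: "'a::euclidean_space set" and \<phi> \<psi> :: "'a \<Rightarrow> 'a"
    and \<phi>' \<psi>' :: "'a \<Rightarrow> 'a \<Rightarrow>\<^sub>L 'a" and \<phi>'' :: "'a \<Rightarrow> 'a \<Rightarrow>\<^sub>L ('a \<Rightarrow>\<^sub>L 'a)"
  assumes open_U: "open U" and open_V: "open V" and hom: "homeomorphism U V \<phi> \<psi>"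
    and \<phi>: "\<And>x. x \<in> U \<Longrightarrow> (\<phi> has_derivative blinfun_apply (\<phi>' x)) (at x)"
    and \<phi>': "\<And>x. x \<in> U \<Longrightarrow> (\<phi>' has_derivative blinfun_apply (\<phi>'' x)) (at x)"
    and cont_\<phi>'': "continuous_on U \<phi>''"
    and \<psi>: "\<And>w. w \<in> V \<Longrightarrow> (\<psi> has_derivative blinfun_apply (\<psi>' w)) (at w)"
    and cont_\<psi>': "continuous_on V \<psi>'"
    and L: "subspace L" and slice: "\<phi> ` (S \<inter> U) = L \<inter> V"
begin

lemma \<phi>_in: "x \<in> U \<Longrightarrow> \<phi> x \<in> V" and \<psi>_in: "w \<in> V \<Longrightarrow> \<psi> w \<in> U"
  and \<psi>_\<phi>: "x \<in> U \<Longrightarrow> \<psi> (\<phi> x) = x" and \<phi>_\<psi>: "w \<in> V \<Longrightarrow> \<phi> (\<psi> w) = w"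
  using hom by (auto simp: homeomorphism_def)

lemma \<psi>'_\<phi>': "x \<in> U \<Longrightarrow> \<psi>' (\<phi> x) (\<phi>' x h) = h"
proof -
  assume x: "x \<in> U"
  have "((\<lambda>y. \<psi> (\<phi> y)) has_derivative (\<lambda>h. \<psi>' (\<phi> x) (\<phi>' x h))) (at x)"
    using has_derivative_compose[OF \<phi>[OF x] \<psi>[OF \<phi>_in[OF x]]] .
  moreover have "((\<lambda>y. \<psi> (\<phi> y)) has_derivative (\<lambda>h. h)) (at x)"
    using has_derivative_ident open_U x
    by (rule has_derivative_transform_within_open) (simp add: \<psi>_\<phi>)
  ultimately show ?thesis
    by (metis has_derivative_unique)
qed

lemma \<phi>'_\<psi>': "x \<in> U \<Longrightarrow> \<phi>' x (\<psi>' (\<phi> x) h) = h"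
proof -
  assume x: "x \<in> U"
  have "((\<lambda>w. \<phi> (\<psi> w)) has_derivative (\<lambda>h. \<phi>' (\<psi> (\<phi> x)) (\<psi>' (\<phi> x) h))) (at (\<phi> x))"
    using has_derivative_compose[OF \<psi>[OF \<phi>_in[OF x]] \<phi>[OF \<psi>_in[OF \<phi>_in[OF x]]]] .
  moreover have "((\<lambda>w. \<phi> (\<psi> w)) has_derivative (\<lambda>h. h)) (at (\<phi> x))"
    using has_derivative_ident open_V \<phi>_in[OF x]
    by (rule has_derivative_transform_within_open) (simp add: \<phi>_\<psi>)
  ultimately show ?thesis
    using has_derivative_unique \<psi>_\<phi>[OF x] by metis
qed

lemma \<phi>_slice: "x \<in> S \<Longrightarrow> x \<in> U \<Longrightarrow> \<phi> x \<in> L"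
  using slice by blast

lemma \<psi>_slice: "w \<in> L \<Longrightarrow> w \<in> V \<Longrightarrow> \<psi> w \<in> S"
  using slice \<psi>_\<phi> by (smt (verit) IntD1 IntD2 IntI imageE)

text \<open>Curves in \<open>S\<close> and curves in \<open>L\<close> correspond under the chart,
  and the velocities of curves in a subspace are exactly its vectors.\<close>

lemma tangent_space_eq:
  assumes x: "x \<in> S" "x \<in> U"
  shows "tangent_space S x = \<psi>' (\<phi> x) ` L"
proof (intro equalityI subsetI)
  fix u assume "u \<in> tangent_space S x"
  then obtain \<gamma> :: "real \<Rightarrow> 'a" where \<gamma>: "\<gamma> 0 = x" "\<forall>\<^sub>F t in nhds 0. \<gamma> t \<in> S" 
    and d\<gamma>: "(\<gamma> has_vector_derivative u) (at 0)"
    by (auto simp: tangent_space_def)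
  have "((\<lambda>t. \<phi> (\<gamma> t)) has_vector_derivative \<phi>' x u) (at 0)"
    using has_derivative_compose[OF d\<gamma>[unfolded has_vector_derivative_def], of \<phi> "\<phi>' x"] \<phi> x \<gamma>
    by (simp add: has_vector_derivative_def blinfun.scaleR_right)
  \<comment> \<open>The component of the chart curve orthogonal to \<open>L\<close> vanishes near 0,
    so its derivative is zero; hence \<open>\<phi>' x u\<close> equals its projection onto
    \<open>L\<close>.\<close>
  then have d: "((\<lambda>t. \<phi> (\<gamma> t) - closest_point L (\<phi> (\<gamma> t))) has_derivative
      (\<lambda>t. t *\<^sub>R \<phi>' x u - closest_point L (t *\<^sub>R \<phi>' x u))) (at 0)"
    unfolding has_vector_derivative_def
    by (intro has_derivative_diff bounded_linear.has_derivative[OF bounded_linear_closest_point_subspace[OF L]])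
  have "\<gamma> \<midarrow>0\<rightarrow> \<gamma> 0"
    using has_vector_derivative_continuous[OF d\<gamma>] by (simp add: continuous_at)
  then have "(\<gamma> \<longlongrightarrow> \<gamma> 0) (nhds 0)"
    by (simp add: tendsto_at_iff_tendsto_nhds)
  then have "\<forall>\<^sub>F t in nhds 0. \<gamma> t \<in> U"
    using open_U x \<gamma>(1) by (auto dest: topological_tendstoD)
  with \<gamma>(2) have "\<forall>\<^sub>F t in nhds 0. \<phi> (\<gamma> t) - closest_point L (\<phi> (\<gamma> t)) = 0"
    by eventually_elim (simp add: closest_point_self \<phi>_slice)
  then have "((\<lambda>t. \<phi> (\<gamma> t) - closest_point L (\<phi> (\<gamma> t))) has_derivative (\<lambda>t. 0)) (at 0)"
    by (intro has_derivative_transform_eventually[OF has_derivative_const])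
      (auto simp: eventually_nhds_conv_at dest: sym)
  with d have "(\<lambda>t. t *\<^sub>R \<phi>' x u - closest_point L (t *\<^sub>R \<phi>' x u)) = (\<lambda>t. 0)"
    by (rule has_derivative_unique)
  then have "\<phi>' x u = closest_point L (\<phi>' x u)"
    by (metis eq_iff_diff_eq_0 scaleR_one)
  then have "\<phi>' x u \<in> L"
    using closest_point_subspace(1)[OF L] by metis
  then show "u \<in> \<psi>' (\<phi> x) ` L"
    using \<psi>'_\<phi>'[OF x(2), of u] by (metis imageI)
next
  fix u assume "u \<in> \<psi>' (\<phi> x) ` L"
  then obtain l where l: "l \<in> L" and u: "u = \<psi>' (\<phi> x) l"
    by blast
  \<comment> \<open>A straight line in \<open>L\<close> pulled back by the chart realises the
    prescribed velocity.\<close>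
  let ?\<gamma> = "\<lambda>t::real. \<psi> (\<phi> x + t *\<^sub>R l)"
  have "((\<lambda>t. \<phi> x + t *\<^sub>R l) \<longlongrightarrow> \<phi> x + 0 *\<^sub>R l) (nhds (0::real))"
    by (intro tendsto_intros filterlim_ident)
  then have "\<forall>\<^sub>F t in nhds (0::real). \<phi> x + t *\<^sub>R l \<in> V"
    using open_V \<phi>_in[OF x(2)] topological_tendstoD by fastforce
  then have "\<forall>\<^sub>F t in nhds 0. ?\<gamma> t \<in> S"
  proof eventually_elim
    case (elim t)
    moreover have "\<phi> x + t *\<^sub>R l \<in> L"
      using L x l by (intro subspace_add subspace_scale \<phi>_slice)
    ultimately show ?case
      by (simp add: \<psi>_slice)
  qed
  moreover have "(?\<gamma> has_vector_derivative u) (at 0)"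
  proof -
    have "((\<lambda>t::real. \<phi> x + t *\<^sub>R l) has_derivative (\<lambda>t. t *\<^sub>R l)) (at 0)"
      by (auto intro!: derivative_eq_intros)
    from has_derivative_compose[OF this, of \<psi> "\<psi>' (\<phi> x)"] show ?thesis
      using \<psi>[OF \<phi>_in[OF x(2)]] by (simp add: has_vector_derivative_def u blinfun.scaleR_right)
  qed
  moreover have "?\<gamma> 0 = x"
    using \<psi>_\<phi> x by simp
  ultimately show "u \<in> tangent_space S x"
    unfolding tangent_space_def by (intro CollectI exI[of _ ?\<gamma>] conjI)
qed

lemma subspace_tangent_space: "x \<in> S \<Longrightarrow> x \<in> U \<Longrightarrow> subspace (tangent_space S x)"
  by (simp add: tangent_space_eq L linear_subspace_image blinfun.bounded_linear_right 
      bounded_linear.linear)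

end

section \<open>Differentiability of the metric projection\<close>

context slice_chart
begin

text \<open>Normal coordinates on a neighbourhood of a point of \<open>S\<close>: the normal space at
  \<open>\<psi> l\<close> is the image of the orthogonal complement of \<open>L\<close> under the adjoint of
  \<open>\<phi>' (\<psi> l)\<close>.\<close>

definition normal_chart :: "'a \<Rightarrow> 'a"
  where "normal_chart w = \<psi> (closest_point L w) +
    blinfun_adjoint (\<phi>' (\<psi> (closest_point L w))) (w - closest_point L w)"

text \<open>This is the derivative of \<open>normal_chart\<close> by the product rule. The last
  summand comes from the motion of the base point; it vanishes when \<open>w\<close> lies in
  \<open>L\<close>.\<close>

definition normal_chart' :: "'a \<Rightarrow> 'a \<Rightarrow> 'a"
  where "normal_chart' w h = \<psi>' (closest_point L w) (closest_point L h) +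
    (blinfun_adjoint (\<phi>' (\<psi> (closest_point L w))) (h - closest_point L h) +
     blinfun_adjoint (\<phi>'' (\<psi> (closest_point L w)) (\<psi>' (closest_point L w) (closest_point L h)))
       (w - closest_point L w))"

text \<open>The foot point is read in the chart and the normal vector is pulled back by the adjoint
  of \<open>\<psi>'\<close>. Building the inverse from \<open>closest_point S\<close> itself makes
  the metric projection equal to \<psi> after \<open>closest_point L\<close> after
  \<open>normal_chart_inv\<close>, so that differentiating the projection reduces to differentiating
  an inverse.\<close>

definition normal_chart_inv :: "'a \<Rightarrow> 'a"
  where "normal_chart_inv x = \<phi> (closest_point S x) +
    blinfun_adjoint (\<psi>' (\<phi> (closest_point S x))) (x - closest_point S x)"

lemmas bounded_linear_closest_point_L = bounded_linear_closest_point_subspace[OF L]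

lemma has_derivative_normal_chart:
  assumes "closest_point L w \<in> V"
  shows "(normal_chart has_derivative normal_chart' w) (at w)"
proof -
  have d: "(closest_point L has_derivative closest_point L) (at w)"
    by (intro bounded_linear_imp_has_derivative bounded_linear_closest_point_L)
  have d\<psi>: "((\<lambda>w. \<psi> (closest_point L w)) has_derivative
      (\<lambda>h. \<psi>' (closest_point L w) (closest_point L h))) (at w)"
    using has_derivative_compose[OF d \<psi>[OF assms]] .
  have d\<phi>': "((\<lambda>w. \<phi>' (\<psi> (closest_point L w))) has_derivative
      (\<lambda>h. \<phi>'' (\<psi> (closest_point L w)) (\<psi>' (closest_point L w) (closest_point L h)))) (at w)"
    using has_derivative_compose[OF d\<psi> \<phi>'[OF \<psi>_in[OF assms]]] .
  show ?thesis
    unfolding normal_chart_def normal_chart'_def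
    by (intro has_derivative_add d\<psi> bounded_bilinear.FDERIV[OF bounded_bilinear_blinfun_adjoint d\<phi>']
        has_derivative_diff has_derivative_ident d)
qed

text \<open>An explicit bound for the operator norm of
  \<open>normal_chart' w - normal_chart' (\<phi> p)\<close>, with one term for each varying
  ingredient. Its first term also controls the variation of \<open>\<psi>'\<close> alone.\<close>

definition normal_chart_err :: "'a \<Rightarrow> 'a \<Rightarrow> real"
  where "normal_chart_err p w = norm (\<psi>' (closest_point L w) - \<psi>' (\<phi> p)) +
    (norm (\<phi>' (\<psi> (closest_point L w)) - \<phi>' p) +
     norm (\<phi>'' (\<psi> (closest_point L w))) * norm (\<psi>' (closest_point L w)) * norm (w - closest_point L w))"

lemma normal_chart'_center:
  assumes p: "p \<in> S" "p \<in> U"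
  shows "normal_chart' (\<phi> p) h = \<psi>' (\<phi> p) (closest_point L h) + blinfun_adjoint (\<phi>' p) (h - closest_point L h)"
  by (simp add: normal_chart'_def closest_point_self[OF \<phi>_slice[OF p]] \<psi>_\<phi>[OF p(2)]
      linear_0[OF linear_blinfun_adjoint])

lemma normal_chart'_diff_le:
  assumes p: "p \<in> S" "p \<in> U"
  shows "norm (normal_chart' w h - normal_chart' (\<phi> p) h) \<le> normal_chart_err p w * norm h"
proof -
  let ?q = "closest_point L w" and ?l = "closest_point L h"
  let ?D = "\<phi>'' (\<psi> ?q) (\<psi>' ?q ?l)"
  have l: "norm ?l \<le> norm h" and n: "norm (h - ?l) \<le> norm h"
    using L norm_closest_point_subspace_le norm_diff_closest_point_subspace_le by blast+
  have "normal_chart' w h - normal_chart' (\<phi> p) h = (\<psi>' ?q - \<psi>' (\<phi> p)) ?l +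
      (blinfun_adjoint (\<phi>' (\<psi> ?q) - \<phi>' p) (h - ?l) + blinfun_adjoint ?D (w - ?q))"
    unfolding normal_chart'_center[OF p]
    by (simp add: normal_chart'_def blinfun.diff_left blinfun_adjoint_diff_left)
  also have "norm \<dots> \<le> norm ((\<psi>' ?q - \<psi>' (\<phi> p)) ?l) +
      (norm (blinfun_adjoint (\<phi>' (\<psi> ?q) - \<phi>' p) (h - ?l)) + norm (blinfun_adjoint ?D (w - ?q)))"
    by (intro norm_triangle_le add_mono order_refl)
  also have "\<dots> \<le> norm (\<psi>' ?q - \<psi>' (\<phi> p)) * norm h + (norm (\<phi>' (\<psi> ?q) - \<phi>' p) * norm h +
      (norm (\<phi>'' (\<psi> ?q)) * (norm (\<psi>' ?q) * norm h)) * norm (w - ?q))"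
  proof (intro add_mono)
    show "norm ((\<psi>' ?q - \<psi>' (\<phi> p)) ?l) \<le> norm (\<psi>' ?q - \<psi>' (\<phi> p)) * norm h"
      using l by (intro order_trans[OF norm_blinfun] mult_left_mono) auto
    show "norm (blinfun_adjoint (\<phi>' (\<psi> ?q) - \<phi>' p) (h - ?l)) \<le> norm (\<phi>' (\<psi> ?q) - \<phi>' p) * norm h"
      using n by (intro order_trans[OF norm_blinfun_adjoint_le] mult_left_mono) auto
    have "norm ?D \<le> norm (\<phi>'' (\<psi> ?q)) * (norm (\<psi>' ?q) * norm h)"
      using l by (intro order_trans[OF norm_blinfun] mult_left_mono) auto
    then show "norm (blinfun_adjoint ?D (w - ?q)) \<le>
        (norm (\<phi>'' (\<psi> ?q)) * (norm (\<psi>' ?q) * norm h)) * norm (w - ?q)"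
      by (intro order_trans[OF norm_blinfun_adjoint_le] mult_right_mono) auto
  qed
  also have "\<dots> = normal_chart_err p w * norm h"
    by (simp add: normal_chart_err_def algebra_simps)
  finally show ?thesis .
qed

lemma tendsto_normal_chart_err:
  assumes p: "p \<in> S" "p \<in> U" and f: "(f \<longlongrightarrow> \<phi> p) F"
  shows "((\<lambda>x. normal_chart_err p (f x)) \<longlongrightarrow> 0) F"
proof -
  have q: "((\<lambda>x. closest_point L (f x)) \<longlongrightarrow> \<phi> p) F"
    using bounded_linear.tendsto[OF bounded_linear_closest_point_L f] closest_point_self[OF \<phi>_slice[OF p]] by simp
  have V: "\<phi> p \<in> V" and [simp]: "\<psi> (\<phi> p) = p"
    using p \<phi>_in \<psi>_\<phi> by auto
  have c\<psi>: "((\<lambda>x. \<psi> (closest_point L (f x))) \<longlongrightarrow> p) F"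
    using isCont_tendsto_compose[OF has_derivative_continuous[OF \<psi>[OF V]] q] by simp
  have c\<psi>': "((\<lambda>x. \<psi>' (closest_point L (f x))) \<longlongrightarrow> \<psi>' (\<phi> p)) F"
    using cont_\<psi>' open_V V q by (metis continuous_on_eq_continuous_at isCont_tendsto_compose)
  have c\<phi>': "((\<lambda>x. \<phi>' (\<psi> (closest_point L (f x)))) \<longlongrightarrow> \<phi>' p) F"
    using isCont_tendsto_compose[OF has_derivative_continuous[OF \<phi>'[OF p(2)]] c\<psi>] .
  have c\<phi>'': "((\<lambda>x. \<phi>'' (\<psi> (closest_point L (f x)))) \<longlongrightarrow> \<phi>'' p) F"
    using cont_\<phi>'' open_U p c\<psi> by (metis continuous_on_eq_continuous_at isCont_tendsto_compose)
  have "((\<lambda>x. normal_chart_err p (f x)) \<longlongrightarrow> norm (\<psi>' (\<phi> p) - \<psi>' (\<phi> p)) +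
      (norm (\<phi>' p - \<phi>' p) + norm (\<phi>'' p) * norm (\<psi>' (\<phi> p)) * norm (\<phi> p - \<phi> p))) F"
    unfolding normal_chart_err_def by (intro tendsto_intros q f c\<psi>' c\<phi>' c\<phi>'')
  then show ?thesis
    by simp
qed

text \<open>At the centre the two summands of the derivative are its tangential and normal parts:
  pairing the adjoint term with \<open>\<psi>' (\<phi> p) l\<close> gives the inner product of
  \<open>h - closest_point L h\<close> with \<open>l\<close>, which is 0 for \<open>l\<close> in
  \<open>L\<close>.\<close>

lemma closest_point_tangent_space_normal_chart':
  assumes p: "p \<in> S" "p \<in> U"
  shows "closest_point (tangent_space S p) (normal_chart' (\<phi> p) h) = \<psi>' (\<phi> p) (closest_point L h)"
proof (rule closest_point_subspace_eqI)
  show "subspace (tangent_space S p)"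
    using p by (rule subspace_tangent_space)
  show "\<psi>' (\<phi> p) (closest_point L h) \<in> tangent_space S p"
    using p by (simp add: tangent_space_eq closest_point_subspace(1)[OF L])
  fix z assume "z \<in> tangent_space S p"
  then obtain l where "l \<in> L" "z = \<psi>' (\<phi> p) l"
    using p by (auto simp: tangent_space_eq)
  then show "(normal_chart' (\<phi> p) h - \<psi>' (\<phi> p) (closest_point L h)) \<bullet> z = 0"
    using p closest_point_subspace(2)[OF L] by (simp add: normal_chart'_center inner_blinfun_adjoint \<phi>'_\<psi>')
qed

text \<open>In finite dimension injectivity gives a lower bound. A kernel vector has zero tangential
  part, hence no component in \<open>L\<close>; what is left is killed because
  \<open>\<phi>' p\<close> is onto.\<close>

lemma normal_chart'_center_bounded_below:
  assumes p: "p \<in> S" "p \<in> U"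
  obtains c where "c > 0" "\<And>h. c * norm h \<le> norm (normal_chart' (\<phi> p) h)"
proof -
  have "normal_chart' (\<phi> p) h = 0 \<longrightarrow> h = 0" for h
  proof
    assume 0: "normal_chart' (\<phi> p) h = 0"
    have "\<psi>' (\<phi> p) (closest_point L h) = closest_point (tangent_space S p) 0"
      using closest_point_tangent_space_normal_chart'[OF p, of h] 0 by simp
    also have "\<dots> = 0"
      using linear_0[OF linear_closest_point_subspace[OF subspace_tangent_space[OF p]]] .
    finally have l: "\<psi>' (\<phi> p) (closest_point L h) = 0" .
    then have "closest_point L h = 0"
      using \<phi>'_\<psi>'[OF p(2), of "closest_point L h"] by simp
    with 0 have "blinfun_adjoint (\<phi>' p) h = 0"
      by (simp add: normal_chart'_center[OF p])
    then have "h \<bullet> \<phi>' p (\<psi>' (\<phi> p) h) = 0"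
      using inner_blinfun_adjoint[of "\<phi>' p" h] by (metis inner_zero_left)
    then show "h = 0"
      using \<phi>'_\<psi>'[OF p(2)] by simp
  qed
  moreover have "bounded_linear (normal_chart' (\<phi> p))"
    using has_derivative_normal_chart closest_point_self[OF \<phi>_slice[OF p]] \<phi>_in[OF p(2)]
    by (metis has_derivative_bounded_linear)
  ultimately obtain c where "c > 0" "\<forall>h\<in>UNIV. c * norm h \<le> norm (normal_chart' (\<phi> p) h)"
    using injective_imp_isometric[of UNIV "normal_chart' (\<phi> p)"] by auto
  then show ?thesis
    using that by blast
qed

text \<open>\<open>x - closest_point S x\<close> is orthogonal to the tangent space, that is, to the
  image of \<open>L\<close> under \<open>\<psi>'\<close>; taking adjoints, the second summand of
  \<open>normal_chart_inv\<close> is orthogonal to \<open>L\<close>.\<close>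

lemma closest_point_L_normal_chart_inv:
  assumes "closed S" "S \<noteq> {}" "closest_point S x \<in> U"
  shows "closest_point L (normal_chart_inv x) = \<phi> (closest_point S x)"
proof (rule closest_point_subspace_eqI[OF L])
  have S: "closest_point S x \<in> S"
    using assms by (simp add: closest_point_in_set)
  show "\<phi> (closest_point S x) \<in> L"
    using S assms by (simp add: \<phi>_slice)
  show "(normal_chart_inv x - \<phi> (closest_point S x)) \<bullet> l = 0" if "l \<in> L" for l
    using orthogonal_tangent_space_closest_point[OF assms(1), of "\<psi>' (\<phi> (closest_point S x)) l" x] 
      that S assms
    by (auto simp: normal_chart_inv_def inner_blinfun_adjoint tangent_space_eq)
qed

text \<open>The two adjoints cancel because \<open>\<psi>'\<close> after \<open>\<phi>'\<close> is
  the identity, so the foot point and the normal vector are both recovered.\<close>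

lemma normal_chart_normal_chart_inv:
  assumes "closed S" "S \<noteq> {}" "closest_point S x \<in> U"
  shows "normal_chart (normal_chart_inv x) = x"
proof -
  let ?a = "closest_point S x"
  have "blinfun_adjoint (\<phi>' ?a) (blinfun_adjoint (\<psi>' (\<phi> ?a)) (x - ?a)) \<bullet> h = (x - ?a) \<bullet> h" for h
    using assms by (simp add: inner_blinfun_adjoint \<psi>'_\<phi>')
  then have "blinfun_adjoint (\<phi>' ?a) (blinfun_adjoint (\<psi>' (\<phi> ?a)) (x - ?a)) = x - ?a"
    using vector_eq_rdot by blast
  then show ?thesis
    using assms by (simp add: normal_chart_def closest_point_L_normal_chart_inv \<psi>_\<phi>) (simp add: normal_chart_inv_def)
qed

lemma isCont_normal_chart_inv:
  assumes c: "isCont (closest_point S) x" and U: "closest_point S x \<in> U"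
  shows "isCont normal_chart_inv x"
  unfolding normal_chart_inv_def
proof (intro continuous_intros c bounded_bilinear.continuous[OF bounded_bilinear_blinfun_adjoint])
  show c\<phi>: "isCont (\<lambda>x. \<phi> (closest_point S x)) x"
    using isCont_o2[OF c has_derivative_continuous[OF \<phi>[OF U]]] .
  have "isCont \<psi>' (\<phi> (closest_point S x))"
    using cont_\<psi>' open_V \<phi>_in[OF U] by (simp add: continuous_on_eq_continuous_at)
  then show "isCont (\<lambda>x. \<psi>' (\<phi> (closest_point S x))) x"
    by (rule isCont_o2[OF c\<phi>])
qed

end

text \<open>\<open>normal_chart_inv\<close> is a continuous right inverse of a differentiable map
  with invertible derivative, hence differentiable; continuity comes from the reach. Composing with
  \<open>closest_point L\<close> and \<psi> differentiates the metric projection. Both estimates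
  compare a nearby point with \<open>p\<close>: the derivative is almost the projector onto the
  tangent space at \<open>p\<close>, and normals at nearby foot points are almost normal
  there.\<close>

lemma (in slice_chart) closest_point_derivative:
  assumes p: "p \<in> S" "p \<in> U" and S: "closed S" and reach: "ereal \<rho> \<le> reach S" "0 < \<rho>" and \<epsilon>: "0 < \<epsilon>"
  shows "\<forall>\<^sub>F x in nhds p. \<exists>D. (closest_point S has_derivative D) (at x) \<and>
    (\<forall>h. norm (D h - closest_point (tangent_space S p) h) \<le> \<epsilon> * norm h) \<and>
    norm (closest_point (tangent_space S p) (x - closest_point S x)) \<le> \<epsilon> * norm (x - closest_point S x)"
proof -
  let ?E = "tangent_space S p"
  have ne: "S \<noteq> {}"
    using p by auto
  have E: "subspace ?E"
    using p by (rule subspace_tangent_space)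
  obtain c where c: "c > 0" "\<And>h. c * norm h \<le> norm (normal_chart' (\<phi> p) h)"
    using normal_chart'_center_bounded_below[OF p] by blast
  have cpp: "closest_point S p = p"
    using p(1) by (rule closest_point_self)
  have infp: "infdist p S < \<rho>"
    using p reach by simp
  have contp: "isCont (closest_point S) p"
    by (rule isCont_closest_point_reach[OF S ne reach(1) infp])
  have ev: "\<forall>\<^sub>F x in nhds p. infdist x S < \<rho> \<and> closest_point S x \<in> U"
  proof (intro eventually_conj)
    have "((\<lambda>x. infdist x S) \<longlongrightarrow> infdist p S) (nhds p)"
      by (intro tendsto_intros filterlim_ident)
    then show "\<forall>\<^sub>F x in nhds p. infdist x S < \<rho>"
      using infp order_tendstoD(2) by blast
    have "(closest_point S \<longlongrightarrow> closest_point S p) (nhds p)"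
      using contp by (simp add: continuous_at tendsto_at_iff_tendsto_nhds)
    then show "\<forall>\<^sub>F x in nhds p. closest_point S x \<in> U"
      using cpp p open_U by (auto dest: topological_tendstoD)
  qed
  \<comment> \<open>The bound \<open>c / 2\<close> keeps the perturbed derivative bounded below by
    \<open>c / 2\<close>; the bound \<open>\<epsilon> * c / 4\<close> lets two errors of size \<eta>
    fit into \<epsilon> times that lower bound.\<close>
  define \<eta> where "\<eta> = min (c / 2) (\<epsilon> * c / 4)"
  have \<eta>: "0 < \<eta>" "\<eta> \<le> c / 2" "\<eta> \<le> \<epsilon> * c / 4"
    using c \<epsilon> by (auto simp: \<eta>_def)
  have "normal_chart_inv p = \<phi> p"
    using p by (simp add: normal_chart_inv_def closest_point_self linear_0[OF linear_blinfun_adjoint])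
  then have "(normal_chart_inv \<longlongrightarrow> \<phi> p) (nhds p)"
    using isCont_normal_chart_inv[OF contp] cpp p
    by (metis continuous_at tendsto_at_iff_tendsto_nhds)
  then have "((\<lambda>x. normal_chart_err p (normal_chart_inv x)) \<longlongrightarrow> 0) (nhds p)"
    by (rule tendsto_normal_chart_err[OF p])
  then have ev1: "\<forall>\<^sub>F x in nhds p. normal_chart_err p (normal_chart_inv x) < \<eta>"
    using \<eta>(1) order_tendstoD(2) by blast
  have ev2: "\<forall>\<^sub>F x in nhds p. normal_chart_err p (normal_chart_inv x) * norm (\<phi>' p) < \<epsilon>"
    using tendsto_mult_left_zero[OF \<open>((\<lambda>x. normal_chart_err p (normal_chart_inv x)) \<longlongrightarrow> 0) (nhds p)\<close>]
      \<epsilon> order_tendstoD(2) by blast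
  \<comment> \<open>Differentiating at \<open>x\<close> requires the chart formulas on a whole
    neighbourhood of \<open>x\<close>, not only at \<open>x\<close>.\<close>
  have "\<forall>\<^sub>F x in nhds p. \<forall>\<^sub>F z in nhds x. infdist z S < \<rho> \<and> closest_point S z \<in> U"
    using ev by (simp add: eventually_eventually)
  with ev ev1 ev2 show ?thesis
  proof eventually_elim
    case (elim x)
    then have infx: "infdist x S < \<rho>" and aU: "closest_point S x \<in> U"
      by auto
    define a where "a = closest_point S x"
    define w where "w = normal_chart_inv x"
    have aS: "a \<in> S"
      using S ne by (simp add: a_def closest_point_in_set)
    have cont: "isCont (closest_point S) x"
      by (rule isCont_closest_point_reach[OF S ne reach(1) infx])
    have q: "closest_point L w = \<phi> a"
      using closest_point_L_normal_chart_inv[OF S ne aU] by (simp add: a_def w_def)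
    have V: "\<phi> a \<in> V"
      using \<phi>_in[OF aU] by (simp add: a_def)
    let ?\<kappa> = "normal_chart_err p w"
    have \<kappa>\<psi>: "norm (\<psi>' (\<phi> a) - \<psi>' (\<phi> p)) \<le> ?\<kappa>"
      by (simp add: normal_chart_err_def q)
    have \<kappa>: "?\<kappa> \<le> \<eta>"
      using elim by (simp add: w_def)
    have dN: "(normal_chart has_derivative normal_chart' w) (at w)"
      using has_derivative_normal_chart V q by simp
    have low: "c / 2 * norm h \<le> norm (normal_chart' w h)" for h
    proof -
      have "norm (normal_chart' w h - normal_chart' (\<phi> p) h) \<le> \<eta> * norm h"
        using normal_chart'_diff_le[OF p] \<kappa> mult_right_mono norm_ge_zero order_trans by metis
      also have "\<dots> \<le> c / 2 * norm h"
        using \<eta> by (intro mult_right_mono) auto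
      finally show ?thesis
        using c(2)[of h] norm_triangle_ineq2[of "normal_chart' (\<phi> p) h" "normal_chart' w h"]
        by (simp add: norm_minus_commute)
    qed
    have lin: "linear (normal_chart' w)"
      using dN has_derivative_linear by blast
    have inj: "inj (normal_chart' w)"
      unfolding linear_injective_0[OF lin] using low c(1)
      by (metis half_gt_zero mult_le_0_iff norm_eq_zero norm_le_zero_iff not_le)
    then obtain G where G: "linear G" "\<And>h. G (normal_chart' w h) = h" "\<And>y. normal_chart' w (G y) = y"
      using linear_injective_isomorphism[OF lin] by metis
    obtain T where T: "open T" "x \<in> T" "\<And>z. z \<in> T \<Longrightarrow> infdist z S < \<rho> \<and> closest_point S z \<in> U"
      using elim by (auto simp: eventually_nhds)
    have dG: "(normal_chart_inv has_derivative G) (at x)"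
    proof (rule has_derivative_inverse_basic)
      show "(normal_chart has_derivative normal_chart' w) (at (normal_chart_inv x))"
        using dN by (simp add: w_def)
      show "bounded_linear G"
        using G(1) by (simp add: linear_conv_bounded_linear)
      show "G \<circ> normal_chart' w = id"
        using G(2) by auto
      show "isCont normal_chart_inv x"
        using isCont_normal_chart_inv[OF cont aU] .
      show "normal_chart (normal_chart_inv z) = z" if "z \<in> T" for z
        using normal_chart_normal_chart_inv[OF S ne] T(3)[OF that] by blast
    qed (fact T)+
    define D where "D = (\<lambda>y. \<psi>' (\<phi> a) (closest_point L (G y)))"
    have "((\<lambda>z. closest_point L (normal_chart_inv z)) has_derivative (\<lambda>y. closest_point L (G y))) (at x)"
      using bounded_linear.has_derivative[OF bounded_linear_closest_point_L dG] .
    from has_derivative_compose[OF this, of \<psi> "\<psi>' (\<phi> a)"]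
    have "((\<lambda>z. \<psi> (closest_point L (normal_chart_inv z))) has_derivative D) (at x)"
      using \<psi>[OF V] q by (simp add: D_def w_def)
    then have "(closest_point S has_derivative D) (at x)"
      using T closest_point_L_normal_chart_inv[OF S ne] \<psi>_\<phi>
      by (elim has_derivative_transform_within_open) auto
    moreover have "norm (D y - closest_point ?E y) \<le> \<epsilon> * norm y" for y
    proof -
      define h where "h = G y"
      have y: "y = normal_chart' w h"
        using G(3) by (simp add: h_def)
      \<comment> \<open>At the centre the projection of \<open>normal_chart'\<close> onto the
        tangent space is known exactly, so the comparison with \<open>D\<close> reduces to the
        variation of \<open>\<psi>'\<close> and of \<open>normal_chart'\<close>.\<close>
      have "closest_point ?E y = \<psi>' (\<phi> p) (closest_point L h) + closest_point ?E (normal_chart' w h - normal_chart' (\<phi> p) h)"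
        using closest_point_tangent_space_normal_chart'[OF p]
        by (simp add: y linear_diff[OF linear_closest_point_subspace[OF E]])
      then have "D y - closest_point ?E y = (\<psi>' (\<phi> a) - \<psi>' (\<phi> p)) (closest_point L h) 
          - closest_point ?E (normal_chart' w h - normal_chart' (\<phi> p) h)"
        by (simp add: D_def h_def blinfun.diff_left)
      also have "norm \<dots> \<le> \<eta> * norm h + \<eta> * norm h"
      proof (intro norm_triangle_le_diff add_mono)
        have "norm ((\<psi>' (\<phi> a) - \<psi>' (\<phi> p)) (closest_point L h)) \<le> 
            norm (\<psi>' (\<phi> a) - \<psi>' (\<phi> p)) * norm (closest_point L h)"
          by (rule norm_blinfun)
        also have "\<dots> \<le> \<eta> * norm h"
          using \<kappa>\<psi> \<kappa> norm_closest_point_subspace_le[OF L] \<eta> by (intro mult_mono) auto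
        finally show "norm ((\<psi>' (\<phi> a) - \<psi>' (\<phi> p)) (closest_point L h)) \<le> \<eta> * norm h" .
        have "norm (closest_point ?E (normal_chart' w h - normal_chart' (\<phi> p) h)) \<le> norm (normal_chart' w h - normal_chart' (\<phi> p) h)"
          by (rule norm_closest_point_subspace_le[OF E])
        also have "\<dots> \<le> ?\<kappa> * norm h"
          by (rule normal_chart'_diff_le[OF p])
        also have "\<dots> \<le> \<eta> * norm h"
          using \<kappa> by (intro mult_right_mono) auto
        finally show "norm (closest_point ?E (normal_chart' w h - normal_chart' (\<phi> p) h)) \<le> \<eta> * norm h" .
      qed
      also have "\<dots> \<le> \<epsilon> * (c / 2 * norm h)"
        using mult_right_mono[OF \<eta>(3), of "norm h"] by simp
      also have "\<dots> \<le> \<epsilon> * norm y"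
        using low[of h] \<epsilon> by (simp add: y)
      finally show ?thesis .
    qed
    moreover have "norm (closest_point ?E (x - a)) \<le> \<epsilon> * norm (x - a)"
    proof -
      define e where "e = closest_point ?E (x - a)"
      have "e \<in> ?E"
        using E by (simp add: e_def closest_point_subspace)
      then obtain l where l: "l \<in> L" "e = \<psi>' (\<phi> p) l"
        using p by (auto simp: tangent_space_eq)
      have nl: "norm l \<le> norm (\<phi>' p) * norm e"
        using norm_blinfun[of "\<phi>' p" e] \<phi>'_\<psi>'[OF p(2)] l by simp
      \<comment> \<open>The vector \<open>e\<close>, tangent at \<open>p\<close>, is transported
        through the chart to a vector tangent at \<open>a\<close>. That one is orthogonal to
        \<open>x - a\<close>, so only the change of \<open>\<psi>'\<close> contributes to the inner
        product with \<open>e\<close>.\<close>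
      have "\<psi>' (\<phi> a) l \<in> tangent_space S a"
        using l aS aU by (auto simp: tangent_space_eq a_def)
      then have orth: "(x - a) \<bullet> \<psi>' (\<phi> a) l = 0"
        using orthogonal_tangent_space_closest_point[OF S] by (simp add: a_def)
      have "(norm e)\<^sup>2 = (x - a) \<bullet> e"
        using inner_closest_point_subspace[OF E] by (simp add: e_def)
      also have "\<dots> = (x - a) \<bullet> (\<psi>' (\<phi> p) - \<psi>' (\<phi> a)) l"
        using orth by (simp add: l blinfun.diff_left inner_diff_right)
      also have "\<dots> \<le> norm (x - a) * norm ((\<psi>' (\<phi> p) - \<psi>' (\<phi> a)) l)"
        by (rule norm_cauchy_schwarz)
      also have "\<dots> \<le> norm (x - a) * (?\<kappa> * (norm (\<phi>' p) * norm e))"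
        using \<kappa>\<psi> nl by (intro mult_left_mono order_trans[OF norm_blinfun] mult_mono)
          (auto simp: norm_minus_commute normal_chart_err_def)
      also have "\<dots> = (?\<kappa> * norm (\<phi>' p)) * (norm (x - a) * norm e)"
        by (simp add: algebra_simps)
      also have "\<dots> \<le> \<epsilon> * (norm (x - a) * norm e)"
        using elim by (intro mult_right_mono) (auto simp: w_def)
      finally have "norm e * norm e \<le> (\<epsilon> * norm (x - a)) * norm e"
        by (simp add: power2_eq_square algebra_simps)
      then show ?thesis
        using \<epsilon> by (cases "norm e = 0") (auto simp: e_def mult_le_cancel_right)
    qed
    ultimately show ?case
      unfolding a_def by blast
  qed
qed

section \<open>Transfer from slice charts to C^2 submanifolds\<close>

lemma C2_submanifold_chart:
  assumes "C2_submanifold k S" "p \<in> S"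
  obtains U V L \<phi> \<psi> \<phi>' \<psi>' \<phi>'' where "p \<in> U" "slice_chart S U V L \<phi> \<psi> \<phi>' \<psi>' \<phi>''"
proof -
  obtain U V L and \<phi> \<psi> :: "'a \<Rightarrow> 'a" where *: "open U" "p \<in> U" "open V" "homeomorphism U V \<phi> \<psi>"
    "C2_on \<phi> U" "C2_on \<psi> V" "subspace L" "\<phi> ` (S \<inter> U) = L \<inter> V"
    using assms unfolding C2_submanifold_def by metis
  obtain \<phi>' :: "'a \<Rightarrow> 'a \<Rightarrow>\<^sub>L 'a" and \<phi>'' :: "'a \<Rightarrow> 'a \<Rightarrow>\<^sub>L ('a \<Rightarrow>\<^sub>L 'a)" where
    \<phi>: "\<forall>x\<in>U. (\<phi> has_derivative blinfun_apply (\<phi>' x)) (at x)"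
    "\<forall>x\<in>U. (\<phi>' has_derivative blinfun_apply (\<phi>'' x)) (at x)" "continuous_on U \<phi>''"
    using *(5) unfolding C2_on_def by blast
  obtain \<psi>' :: "'a \<Rightarrow> 'a \<Rightarrow>\<^sub>L 'a" and \<psi>'' :: "'a \<Rightarrow> 'a \<Rightarrow>\<^sub>L ('a \<Rightarrow>\<^sub>L 'a)" where
    \<psi>: "\<forall>x\<in>V. (\<psi> has_derivative blinfun_apply (\<psi>' x)) (at x)"
    "\<forall>x\<in>V. (\<psi>' has_derivative blinfun_apply (\<psi>'' x)) (at x)"
    using *(6) unfolding C2_on_def by blast
  have "continuous_on V \<psi>'"
    using \<psi>(2) by (intro continuous_at_imp_continuous_on ballI has_derivative_continuous) auto
  with * \<phi> \<psi> have "slice_chart S U V L \<phi> \<psi> \<phi>' \<psi>' \<phi>''"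
    by unfold_locales auto
  with *(2) show ?thesis
    by (rule that)
qed

lemma subspace_tangent_space_C2_submanifold:
  assumes "C2_submanifold k S" "p \<in> S"
  shows "subspace (tangent_space S p)"
  using C2_submanifold_chart[OF assms] assms(2) slice_chart.subspace_tangent_space by metis

lemma closest_point_C2_submanifold:
  assumes "C2_submanifold k S" "p \<in> S" "closed S" "ereal \<rho> \<le> reach S" "0 < \<rho>" "0 < \<epsilon>"
  shows "\<forall>\<^sub>F x in nhds p. \<exists>D. (closest_point S has_derivative D) (at x) \<and>
    (\<forall>h. norm (D h - closest_point (tangent_space S p) h) \<le> \<epsilon> * norm h) \<and>
    norm (closest_point (tangent_space S p) (x - closest_point S x)) \<le> \<epsilon> * norm (x - closest_point S x)"
proof -
  obtain U V L \<phi> \<psi> \<phi>' \<psi>' \<phi>'' where "p \<in> U" "slice_chart S U V L \<phi> \<psi> \<phi>' \<psi>' \<phi>''"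
    using C2_submanifold_chart[OF assms(1,2)] .
  then show ?thesis
    using slice_chart.closest_point_derivative assms by blast
qed

section \<open>The linearised field\<close>

lemma closest_point_subspace_selfadjoint:
  fixes E :: "'a::euclidean_space set"
  assumes "subspace E"
  shows "x \<bullet> closest_point E y = closest_point E x \<bullet> y"
proof -
  have "x \<bullet> closest_point E y = closest_point E x \<bullet> closest_point E y" for x y
    using closest_point_subspace(2)[OF assms closest_point_subspace(1)[OF assms], of x y]
    by (simp add: inner_diff_left)
  from this[of x y] this[of y x] show ?thesis
    by (metis inner_commute)
qed

text \<open>Orthogonal projectors are self-adjoint and idempotent, so both sides expand to the same
  combination of the two squared norms and the mixed inner product of the projections of
  \<open>v\<close>.\<close>

lemma inner_linearised_rrr:
  fixes E F :: "'a::euclidean_space set"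
  assumes E: "subspace E" and F: "subspace F"
  shows "v \<bullet> (closest_point F (2 *\<^sub>R closest_point E v - v) - closest_point E v) =
    - (norm (closest_point F v - closest_point E v))\<^sup>2"
proof -
  have "v \<bullet> closest_point F (2 *\<^sub>R closest_point E v - v) =
      2 * (closest_point F v \<bullet> closest_point E v) - v \<bullet> closest_point F v"
    unfolding closest_point_subspace_selfadjoint[OF F] by (simp add: inner_diff_right inner_commute)
  moreover have "(norm (closest_point F v - closest_point E v))\<^sup>2 =
      (norm (closest_point F v))\<^sup>2 + (norm (closest_point E v))\<^sup>2 - 2 * (closest_point F v \<bullet> closest_point E v)"
    by (simp add: power2_norm_eq_inner inner_diff_left inner_diff_right inner_commute)
  ultimately show ?thesis
    by (simp add: inner_diff_right inner_closest_point_subspace[OF E] inner_closest_point_subspace[OF F])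
qed

text \<open>The map is injective on pairs of normals. If the two projections agree, their common
  value lies in \<open>E\<close>, so it is orthogonal to \<open>p\<close>; being the projection of
  \<open>p\<close> onto \<open>F\<close>, it is then 0. Hence \<open>p\<close> and \<open>q\<close>
  are orthogonal to both \<open>E\<close> and \<open>F\<close>, and these span the space.\<close>

lemma transverse_normals_bounded_below:
  fixes E F :: "'a::euclidean_space set"
  assumes E: "subspace E" and F: "subspace F" and EF: "{a + b |a b. a \<in> E \<and> b \<in> F} = UNIV"
  obtains c where "c > 0"
    "\<And>p q. \<lbrakk>\<And>e. e \<in> E \<Longrightarrow> p \<bullet> e = 0; \<And>f. f \<in> F \<Longrightarrow> q \<bullet> f = 0\<rbrakk> \<Longrightarrow>
      c * (norm p + norm q) \<le> norm (closest_point F p - closest_point E q)"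
proof -
  define s where "s = {(p, q). (\<forall>e\<in>E. p \<bullet> e = 0) \<and> (\<forall>f\<in>F. q \<bullet> f = 0)}"
  define T where "T = (\<lambda>(p, q). closest_point F p - closest_point E q)"
  have sub: "subspace s"
    by (auto simp: s_def subspace_def inner_add_left zero_prod_def)
  have T: "bounded_linear T"
    unfolding T_def split_beta
    by (intro bounded_linear_sub bounded_linear_compose[OF bounded_linear_closest_point_subspace]
        E F bounded_linear_fst bounded_linear_snd)
  have "\<forall>z\<in>s. T z = 0 \<longrightarrow> z = 0"
  proof (intro ballI impI)
    fix z assume "z \<in> s" "T z = 0"
    then obtain p q where z: "z = (p, q)" and pE: "\<And>e. e \<in> E \<Longrightarrow> p \<bullet> e = 0"
      and qF: "\<And>f. f \<in> F \<Longrightarrow> q \<bullet> f = 0" and eq: "closest_point F p = closest_point E q"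
      by (auto simp: s_def T_def)
    have "p \<bullet> closest_point F p = 0"
      using pE eq closest_point_subspace(1)[OF E] by metis
    then have F0: "closest_point F p = 0" and E0: "closest_point E q = 0"
      using inner_closest_point_subspace[OF F, of p] eq by auto
    have pF: "p \<bullet> f = 0" if "f \<in> F" for f
      using closest_point_subspace(2)[OF F that, of p] F0 by simp
    have qE: "q \<bullet> e = 0" if "e \<in> E" for e
      using closest_point_subspace(2)[OF E that, of q] E0 by simp
    have "p \<bullet> u = 0 \<and> q \<bullet> u = 0" for u
    proof -
      obtain a b where "u = a + b" "a \<in> E" "b \<in> F"
        using EF by blast
      then show ?thesis
        using pE pF qE qF by (simp add: inner_add_right)
    qed
    then have "p = 0" "q = 0"
      by (meson inner_eq_zero_iff)+
    then show "z = 0"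
      by (simp add: z zero_prod_def)
  qed
  then obtain c where c: "c > 0" "\<And>z. z \<in> s \<Longrightarrow> c * norm z \<le> norm (T z)"
    using injective_imp_isometric[OF closed_subspace[OF sub] sub T] by blast
  show ?thesis
  proof
    \<comment> \<open>The factor 1/2 pays for replacing the norm of the pair by the sum of the two
      norms.\<close>
    show "c / 2 > 0"
      using c by simp
    fix p q assume "\<And>e. e \<in> E \<Longrightarrow> p \<bullet> e = 0" "\<And>f. f \<in> F \<Longrightarrow> q \<bullet> f = 0"
    then have "c * norm (p, q) \<le> norm (closest_point F p - closest_point E q)"
      using c(2)[of "(p, q)"] by (auto simp: s_def T_def)
    moreover have "c * (norm p + norm q) \<le> c * (norm (p, q) + norm (p, q))"
      using c(1) norm_fst_le[of p q] norm_snd_le[of q p] by (intro mult_left_mono add_mono) auto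
    ultimately show "c / 2 * (norm p + norm q) \<le> norm (closest_point F p - closest_point E q)"
      by (simp add: algebra_simps)
  qed
qed

text \<open>The estimates for the linear model at \<open>p\<close> survive because derivatives and
  normals near \<open>p\<close> are within \<epsilon> of those of the model. The last conclusion
  bounds the distance to \<open>A\<close> by the field; it later turns decay of the field into
  convergence to the intersection.\<close>

lemma rrr_field_local_contraction:
  fixes A B :: "'a::euclidean_space set"
  assumes A: "C2_submanifold k A" "closed A" "ereal \<rho> \<le> reach A"
    and B: "C2_submanifold l B" "closed B" "ereal \<rho> \<le> reach B"
    and \<rho>: "0 < \<rho>" and trans: "transverse A B" and p: "p \<in> A \<inter> B"
  shows "\<exists>\<sigma>>0. \<forall>\<^sub>F x in nhds p. \<exists>D. (rrr_field A B has_derivative D) (at x) \<and>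
    rrr_field A B x \<bullet> D (rrr_field A B x) \<le> - \<sigma> * (norm (rrr_field A B x))\<^sup>2 \<and>
    \<sigma> * norm (x - closest_point A x) \<le> norm (rrr_field A B x)"
proof -
  define E where "E = tangent_space A p"
  define F where "F = tangent_space B p"
  have E: "subspace E" and F: "subspace F"
    using A B p subspace_tangent_space_C2_submanifold by (auto simp: E_def F_def)
  note lE = linear_closest_point_subspace[OF E] and lF = linear_closest_point_subspace[OF F]
  note nE = norm_closest_point_subspace_le[OF E] and nF = norm_closest_point_subspace_le[OF F]
  have "{a + b |a b. a \<in> E \<and> b \<in> F} = UNIV"
    using trans p by (simp add: transverse_def E_def F_def)
  then obtain c where c: "c > 0"
    "\<And>p q. \<lbrakk>\<And>e. e \<in> E \<Longrightarrow> p \<bullet> e = 0; \<And>f. f \<in> F \<Longrightarrow> q \<bullet> f = 0\<rbrakk> \<Longrightarrow>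
      c * (norm p + norm q) \<le> norm (closest_point F p - closest_point E q)"
    using transverse_normals_bounded_below[OF E F] by blast
  \<comment> \<open>The bound 1/4 retains three quarters of the normal vectors, \<open>c/8\<close>
    absorbs their tangential remainders, and \<open>c\<^sup>2/56\<close> keeps the derivative error
    \<open>7 * \<epsilon>\<close> below half of the model rate \<open>c\<^sup>2/4\<close>.\<close>
  define \<epsilon> where "\<epsilon> = min (1/4) (min (c/8) (c\<^sup>2/56))"
  have \<epsilon>: "0 < \<epsilon>" "\<epsilon> \<le> 1/4" "\<epsilon> \<le> c/8" "7 * \<epsilon> \<le> c\<^sup>2/8"
    using c(1) by (auto simp: \<epsilon>_def)
  define \<sigma> where "\<sigma> = min (c\<^sup>2/8) (c/4)"
  have \<sigma>: "0 < \<sigma>" "\<sigma> \<le> c\<^sup>2/8" "\<sigma> \<le> c/4"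
    using c(1) by (auto simp: \<sigma>_def)
  have evA: "\<forall>\<^sub>F x in nhds p. \<exists>D. (closest_point A has_derivative D) (at x) \<and>
    (\<forall>h. norm (D h - closest_point E h) \<le> \<epsilon> * norm h) \<and>
    norm (closest_point E (x - closest_point A x)) \<le> \<epsilon> * norm (x - closest_point A x)"
    unfolding E_def using closest_point_C2_submanifold[OF A(1) _ A(2,3) \<rho> \<epsilon>(1)] p by blast
  have evB: "\<forall>\<^sub>F x in nhds p. \<exists>D. (closest_point B has_derivative D) (at x) \<and>
    (\<forall>h. norm (D h - closest_point F h) \<le> \<epsilon> * norm h) \<and>
    norm (closest_point F (x - closest_point B x)) \<le> \<epsilon> * norm (x - closest_point B x)"
    unfolding F_def using closest_point_C2_submanifold[OF B(1) _ B(2,3) \<rho> \<epsilon>(1)] p by blast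
  have "isCont (closest_point A) p"
    using eventually_nhds_x_imp_x[OF evA] has_derivative_continuous by blast
  then have "(closest_point A \<longlongrightarrow> p) (nhds p)"
    using closest_point_self[of p A] p by (metis IntD1 continuous_at tendsto_at_iff_tendsto_nhds)
  then have "((\<lambda>x. 2 *\<^sub>R closest_point A x - x) \<longlongrightarrow> 2 *\<^sub>R p - p) (nhds p)"
    by (intro tendsto_intros filterlim_ident)
  then have "(reflection A \<longlongrightarrow> p) (nhds p)"
    unfolding reflection_def[abs_def] by (simp add: scaleR_2)
  then have "\<forall>\<^sub>F x in nhds p. \<exists>D. (closest_point B has_derivative D) (at (reflection A x)) \<and>
    (\<forall>h. norm (D h - closest_point F h) \<le> \<epsilon> * norm h) \<and>
    norm (closest_point F (reflection A x - closest_point B (reflection A x)))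
      \<le> \<epsilon> * norm (reflection A x - closest_point B (reflection A x))"
    using eventually_compose_filterlim[OF evB] by blast
  with evA have "\<forall>\<^sub>F x in nhds p. \<exists>D. (rrr_field A B has_derivative D) (at x) \<and>
    rrr_field A B x \<bullet> D (rrr_field A B x) \<le> - \<sigma> * (norm (rrr_field A B x))\<^sup>2 \<and>
    \<sigma> * norm (x - closest_point A x) \<le> norm (rrr_field A B x)"
  proof eventually_elim
    case (elim x)
    define a where "a = closest_point A x"
    define y where "y = reflection A x"
    define b where "b = closest_point B y"
    define v where "v = rrr_field A B x"
    obtain DA where DA: "(closest_point A has_derivative DA) (at x)"
      "\<And>h. norm (DA h - closest_point E h) \<le> \<epsilon> * norm h"
      "norm (closest_point E (x - a)) \<le> \<epsilon> * norm (x - a)"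
      using elim unfolding a_def by blast
    obtain DB where DB: "(closest_point B has_derivative DB) (at y)"
      "\<And>h. norm (DB h - closest_point F h) \<le> \<epsilon> * norm h"
      "norm (closest_point F (y - b)) \<le> \<epsilon> * norm (y - b)"
      using elim unfolding y_def b_def by blast
    define m where "m = norm (x - a) + norm (y - b)"
    have v: "v = - (x - a) - (y - b)"
      by (simp add: v_def rrr_field_def a_def y_def b_def reflection_def scaleR_2)
    have vm: "norm v \<le> m"
      unfolding v m_def using norm_triangle_ineq4[of "- (x - a)" "y - b"] by (simp add: norm_minus_commute)
    define D where "D = (\<lambda>h. DB (2 *\<^sub>R DA h - h) - DA h)"
    have D: "(rrr_field A B has_derivative D) (at x)"
    proof -
      have "(reflection A has_derivative (\<lambda>h. 2 *\<^sub>R DA h - h)) (at x)"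
        unfolding reflection_def[abs_def]
        by (intro has_derivative_diff has_derivative_scaleR_right has_derivative_ident DA)
      from has_derivative_compose[OF this, of "closest_point B" DB] show ?thesis
        unfolding rrr_field_def[abs_def] D_def using DB(1) DA(1)
        by (intro has_derivative_diff) (simp_all add: y_def)
    qed
    define T where "T = (\<lambda>h. closest_point F (2 *\<^sub>R closest_point E h - h) - closest_point E h)"
    \<comment> \<open>The factor 7 is 4 + 2 + 1: the error of \<open>DB\<close> on a vector of norm
      at most \<open>4 * norm h\<close>, the doubled error of \<open>DA\<close> inside the
      reflection, and the error of the subtracted \<open>DA\<close>.\<close>
    have DT: "norm (D h - T h) \<le> 7 * \<epsilon> * norm h" for h
    proof -
      let ?u = "2 *\<^sub>R DA h - h" and ?d = "DA h - closest_point E h"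
      have "norm (DA h) \<le> norm (closest_point E h) + norm ?d"
        using norm_triangle_ineq2[of "DA h" "closest_point E h"] by linarith
      also have "\<dots> \<le> norm h + 1/4 * norm h"
        using DA(2)[of h] nE[of h] mult_right_mono[OF \<epsilon>(2), of "norm h"] by simp
      finally have "norm (DA h) \<le> norm h + 1/4 * norm h" .
      moreover have "norm ?u \<le> 2 * norm (DA h) + norm h"
        using norm_triangle_ineq4[of "2 *\<^sub>R DA h" h] by simp
      ultimately have "norm ?u \<le> 4 * norm h"
        using norm_ge_zero[of h] by linarith
      then have 1: "norm (DB ?u - closest_point F ?u) \<le> \<epsilon> * (4 * norm h)"
        using DB(2)[of ?u] \<epsilon>(1) by (meson mult_left_mono less_imp_le order_trans)
      have 2: "norm (closest_point F (2 *\<^sub>R ?d)) \<le> 2 * (\<epsilon> * norm h)"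
        using nF[of "2 *\<^sub>R ?d"] DA(2)[of h] by simp
      have "D h - T h = (DB ?u - closest_point F ?u) + closest_point F (2 *\<^sub>R ?d) - ?d"
        by (simp add: D_def T_def linear_diff[OF lF] linear_scale[OF lF] scaleR_diff_right)
      also have "norm \<dots> \<le> \<epsilon> * (4 * norm h) + 2 * (\<epsilon> * norm h) + \<epsilon> * norm h"
        using norm_triangle_ineq4[of "(DB ?u - closest_point F ?u) + closest_point F (2 *\<^sub>R ?d)" ?d]
          norm_triangle_ineq[of "DB ?u - closest_point F ?u" "closest_point F (2 *\<^sub>R ?d)"]
          1 2 DA(2)[of h] by linarith
      finally show ?thesis
        by (simp add: algebra_simps)
    qed
    define w where "w = closest_point F v - closest_point E v"
    have low: "c / 2 * m \<le> norm w"
    proof -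
      \<comment> \<open>\<open>P\<close> and \<open>Q\<close> are exact normals to \<open>E\<close>
        and \<open>F\<close>, to which the transversality bound applies; \<open>R\<close> collects
        the tangential remainders.\<close>
      define P where "P = (x - a) - closest_point E (x - a)"
      define Q where "Q = (y - b) - closest_point F (y - b)"
      define R where "R = closest_point F (closest_point E (x - a)) - closest_point E (x - a) +
        (closest_point F (y - b) - closest_point E (closest_point F (y - b)))"
      have "P \<bullet> e = 0" if "e \<in> E" for e
        unfolding P_def by (rule closest_point_subspace(2)[OF E that])
      moreover have "Q \<bullet> f = 0" if "f \<in> F" for f
        unfolding Q_def by (rule closest_point_subspace(2)[OF F that])
      ultimately have 1: "c * (norm P + norm Q) \<le> norm (closest_point F P - closest_point E Q)"
        by (rule c(2))
      have "norm R \<le> norm (closest_point F (closest_point E (x - a)) - closest_point E (x - a)) +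
        norm (closest_point F (y - b) - closest_point E (closest_point F (y - b)))"
        unfolding R_def by (rule norm_triangle_ineq)
      also have "\<dots> \<le> norm (closest_point E (x - a)) + norm (closest_point F (y - b))"
      \<comment> \<open>Each summand of \<open>R\<close> is the residual of a projection, hence no
        longer than the remainder it is formed from.\<close>
      proof (rule add_mono)
        show "norm (closest_point F (closest_point E (x - a)) - closest_point E (x - a))
            \<le> norm (closest_point E (x - a))"
          using norm_diff_closest_point_subspace_le[OF F] by (metis norm_minus_commute)
        show "norm (closest_point F (y - b) - closest_point E (closest_point F (y - b)))
            \<le> norm (closest_point F (y - b))"
          by (rule norm_diff_closest_point_subspace_le[OF E])
      qed
      also have "\<dots> \<le> \<epsilon> * m"
        using DA(3) DB(3) by (simp add: m_def distrib_left)
      finally have R: "norm R \<le> \<epsilon> * m" .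
      have "closest_point F P - closest_point E Q = - w - R"
        unfolding w_def R_def P_def Q_def v
        by (simp only: linear_diff[OF lF] linear_diff[OF lE] linear_neg[OF lF] linear_neg[OF lE])
          (simp add: algebra_simps)
      then have 2: "norm (closest_point F P - closest_point E Q) \<le> norm w + \<epsilon> * m"
        using R norm_triangle_ineq4[of "- w" R] by simp
      have "norm (x - a) - \<epsilon> * norm (x - a) \<le> norm P" "norm (y - b) - \<epsilon> * norm (y - b) \<le> norm Q"
        using DA(3) DB(3) norm_triangle_ineq2 unfolding P_def Q_def by (smt (verit))+
      then have "m - \<epsilon> * m \<le> norm P + norm Q"
        by (simp add: m_def distrib_left)
      moreover have "3/4 * m \<le> m - \<epsilon> * m"
        using mult_right_mono[OF \<epsilon>(2), of m] by (simp add: m_def)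
      ultimately have "c * (3/4 * m) \<le> c * (norm P + norm Q)"
        using c(1) by (intro mult_left_mono) auto
      moreover have "\<epsilon> * m \<le> c / 8 * m"
        using \<epsilon>(3) by (intro mult_right_mono) (auto simp: m_def)
      moreover have "0 \<le> c * m"
        using c(1) by (simp add: m_def)
      ultimately show ?thesis
        using 1 2 by simp
    qed
    have "v \<bullet> D v \<le> - \<sigma> * (norm v)\<^sup>2"
    proof -
      have "v \<bullet> (D v - T v) \<le> norm v * (7 * \<epsilon> * norm v)"
        using norm_cauchy_schwarz[of v "D v - T v"] mult_left_mono[OF DT[of v], of "norm v"] by simp
      also have "\<dots> = 7 * \<epsilon> * (norm v)\<^sup>2"
        by (simp add: power2_eq_square)
      also have "\<dots> \<le> c\<^sup>2/8 * (norm v)\<^sup>2"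
        using \<epsilon>(4) by (intro mult_right_mono) auto
      finally have 1: "v \<bullet> (D v - T v) \<le> c\<^sup>2/8 * (norm v)\<^sup>2" .
      have "v \<bullet> T v = - (norm w)\<^sup>2"
        using inner_linearised_rrr[OF E F] by (simp add: T_def w_def)
      \<comment> \<open>The model rate is \<open>c\<^sup>2/4\<close>; the derivative error uses up
        half of it and leaves \<open>c\<^sup>2/8\<close>.\<close>
      moreover have "(c / 2 * norm v)\<^sup>2 \<le> (norm w)\<^sup>2"
        using low vm c(1) by (intro power_mono order_trans[OF _ low] mult_left_mono) auto
      ultimately have "v \<bullet> T v \<le> - (c\<^sup>2/4 * (norm v)\<^sup>2)"
        by (simp add: power_mult_distrib power_divide)
      then have "v \<bullet> D v \<le> - (c\<^sup>2/8 * (norm v)\<^sup>2)"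
        using 1 by (simp add: inner_diff_right)
      also have "\<dots> \<le> - \<sigma> * (norm v)\<^sup>2"
        using mult_right_mono[OF \<sigma>(2), of "(norm v)\<^sup>2"] by simp
      finally show ?thesis .
    qed
    moreover have "\<sigma> * norm (x - a) \<le> norm v"
    proof -
      have "norm w \<le> 2 * norm v"
        using norm_triangle_ineq4[of "closest_point F v" "closest_point E v"] nE[of v] nF[of v]
        by (simp add: w_def)
      moreover have "\<sigma> * norm (x - a) \<le> c / 4 * m"
        using \<sigma> by (intro mult_mono) (auto simp: m_def)
      ultimately show ?thesis
        using low by simp
    qed
    ultimately show ?case
      using D unfolding v_def a_def by blast
  qed
  with \<sigma>(1) show ?thesis
    by blast
qed

section \<open>Uniform decay\<close>

text \<open>A Lebesgue number argument: finitely many balls of half radius cover \<open>M\<close>,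
  so a point closer to \<open>M\<close> than every half radius lies in one of the full balls.
  Monotonicity permits the smallest rate to be used for all of them.\<close>

lemma compact_uniform_eventually:
  fixes M :: "'a::metric_space set" and P :: "real \<Rightarrow> 'a \<Rightarrow> bool"
  assumes M: "compact M" and ev: "\<And>p. p \<in> M \<Longrightarrow> \<exists>\<sigma>>0. \<forall>\<^sub>F x in nhds p. P \<sigma> x"
    and mono: "\<And>\<sigma> \<tau> x. \<lbrakk>P \<sigma> x; 0 < \<tau>; \<tau> \<le> \<sigma>\<rbrakk> \<Longrightarrow> P \<tau> x"
  obtains \<sigma> \<delta> where "\<sigma> > 0" "\<delta> > 0" "\<And>x m. \<lbrakk>m \<in> M; dist x m < \<delta>\<rbrakk> \<Longrightarrow> P \<sigma> x"
proof -
  have "\<exists>\<sigma> \<delta>. \<sigma> > 0 \<and> \<delta> > 0 \<and> (\<forall>x. dist x p < \<delta> \<longrightarrow> P \<sigma> x)" if "p \<in> M" for p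
    using ev[OF that] by (auto simp: eventually_nhds_metric)
  then obtain s d where sd: "\<And>p. p \<in> M \<Longrightarrow> s p > 0 \<and> d p > 0 \<and> (\<forall>x. dist x p < d p \<longrightarrow> P (s p) x)"
    by metis
  have "M \<subseteq> (\<Union>p\<in>M. ball p (d p / 2))"
    using sd by force
  then obtain C where C: "C \<subseteq> M" "finite C" "M \<subseteq> (\<Union>p\<in>C. ball p (d p / 2))"
    using compactE_image[OF M, of M "\<lambda>p. ball p (d p / 2)"] by auto
  \<comment> \<open>Inserting 1 keeps the minimum meaningful when the finite cover is empty.\<close>
  define \<sigma> where "\<sigma> = Min (insert 1 (s ` C))"
  define \<delta> where "\<delta> = Min (insert 1 ((\<lambda>p. d p / 2) ` C))"
  show ?thesis
  proof
    show pos: "\<sigma> > 0" "\<delta> > 0"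
      unfolding \<sigma>_def \<delta>_def using C sd by (subst Min_gr_iff; force)+
    fix x m assume "m \<in> M" "dist x m < \<delta>"
    then obtain p where p: "p \<in> C" "dist p m < d p / 2"
      using C by auto
    have "\<sigma> \<le> s p" "\<delta> \<le> d p / 2"
      unfolding \<sigma>_def \<delta>_def using p C by (intro Min_le; auto)+
    moreover from this have "dist x p < d p"
      using p \<open>dist x m < \<delta>\<close> dist_triangle[of x p m] by (simp add: dist_commute)
    ultimately show "P \<sigma> x"
      using sd[of p] p C mono pos by blast
  qed
qed

text \<open>The points of \<open>A\<close> close to \<open>B\<close> but at distance at least \<eta>
  from the intersection form a compact set disjoint from \<open>B\<close>, so their distance to
  \<open>B\<close> has a positive lower bound.\<close>

lemma separated_at_infinity_near_intersection:
  fixes A B :: "'a::euclidean_space set"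
  assumes A: "closed A" and B: "closed B" "B \<noteq> {}"
    and sep: "separated_at_infinity A B" and \<eta>: "\<eta> > 0"
  obtains s where "s > 0" "\<And>a. \<lbrakk>a \<in> A; infdist a B \<le> s\<rbrakk> \<Longrightarrow> \<exists>m\<in>A \<inter> B. dist a m < \<eta>"
proof -
  obtain s0 where s0: "s0 > 0" "bounded {a \<in> A. infdist a B \<le> s0}"
    using sep by (auto simp: separated_at_infinity_def)
  \<comment> \<open>Distance from the intersection is encoded pointwise, which shows closedness and
    also covers an empty intersection, where \<open>infdist\<close> would return the default
    0.\<close>
  define K where "K = {a \<in> A. infdist a B \<le> s0} \<inter> (\<Inter>m\<in>A \<inter> B. {a. \<eta> \<le> dist a m})"
  have "{a \<in> A. infdist a B \<le> s0} = A \<inter> {a. infdist a B \<le> s0}"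
    by auto
  moreover have "closed {a. infdist a B \<le> s0}"
    by (intro closed_Collect_le continuous_intros)
  moreover have "closed (\<Inter>m\<in>A \<inter> B. {a. \<eta> \<le> dist a m})"
    by (intro closed_INT ballI closed_Collect_le continuous_intros)
  ultimately have "closed K"
    unfolding K_def using A by (auto intro!: closed_Int)
  then have K: "compact K"
    using s0(2) by (auto simp: K_def compact_eq_bounded_closed intro: bounded_subset)
  obtain \<mu> where \<mu>: "\<mu> > 0" "\<And>a. a \<in> K \<Longrightarrow> \<mu> \<le> infdist a B"
  proof (cases "K = {}")
    case True
    then show ?thesis
      using that[of 1] by simp
  next
    case False
    have "continuous_on K (\<lambda>a. infdist a B)"
      by (intro continuous_intros)
    from continuous_attains_inf[OF K False this]
    obtain a0 where a0: "a0 \<in> K" "\<And>a. a \<in> K \<Longrightarrow> infdist a0 B \<le> infdist a B"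
      by blast
    have "a0 \<notin> B"
    proof
      assume "a0 \<in> B"
      then have "\<eta> \<le> dist a0 a0"
        using a0(1) unfolding K_def by blast
      then show False
        using \<eta> by simp
    qed
    then have "infdist a0 B > 0"
      using infdist_pos_not_in_closed[OF B] by blast
    then show ?thesis
      using that a0 by blast
  qed
  show ?thesis
  proof
    show "min s0 (\<mu> / 2) > 0"
      using s0 \<mu> by simp
    fix a assume a: "a \<in> A" "infdist a B \<le> min s0 (\<mu> / 2)"
    then have "a \<notin> K"
      using \<mu> by fastforce
    then show "\<exists>m\<in>A \<inter> B. dist a m < \<eta>"
      using a by (auto simp: K_def not_le)
  qed
qed

text \<open>Gronwall's argument: the product \<open>exp (c * t) * f t\<close> has nonpositive
  derivative. At 0 the derivative is one-sided, so monotonicity uses derivatives in the open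
  interval and continuity on the closed one.\<close>

lemma exponential_decay:
  fixes f f' :: "real \<Rightarrow> real"
  assumes "\<And>t. t \<ge> 0 \<Longrightarrow> (f has_real_derivative f' t) (at t within {0..})"
    and "\<And>t. t \<ge> 0 \<Longrightarrow> f' t \<le> - c * f t" and "t \<ge> 0"
  shows "f t \<le> exp (- c * t) * f 0"
proof -
  let ?g = "\<lambda>t. exp (c * t) * f t"
  have g: "(?g has_real_derivative exp (c * s) * (c * f s + f' s)) (at s within {0..})" if "s \<ge> 0" for s
    using assms(1)[OF that] by (auto intro!: derivative_eq_intros simp: algebra_simps)
  have "?g t \<le> ?g 0"
  proof (rule DERIV_nonpos_imp_decreasing_open[of 0 t ?g])
    fix s assume s: "0 < s" "s < t"
    then have "at s within {0..} = at s"
      by (intro at_within_interior) (simp add: interior_real_atLeast)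
    moreover have "exp (c * s) * (c * f s + f' s) \<le> 0"
      using assms(2)[of s] s by (simp add: mult_nonneg_nonpos)
    ultimately show "\<exists>y. (?g has_real_derivative y) (at s) \<and> y \<le> 0"
      using g[of s] s by auto
  next
    have "continuous_on {0..} ?g"
      using g by (intro DERIV_continuous_on) auto
    then show "continuous_on {0..t} ?g"
      by (rule continuous_on_subset) auto
  qed (fact assms(3))
  then show ?thesis
    by (simp add: exp_minus field_simps)
qed

theorem theorem4p2:
  fixes A B :: "'a::euclidean_space set"
    and k l :: nat
    and \<theta>\<^sub>0 \<rho> \<kappa> :: real
  assumes "closed A" and "closed B" and "A \<noteq> {}" and "B \<noteq> {}"
    and "C2_submanifold k A" and "C2_submanifold l B"
    and "transverse A B"
    and "compact (A \<inter> B)"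
    and "separated_at_infinity A B"
    and "\<theta>\<^sub>0 > 0"
    and "\<forall>x\<in>A \<inter> B. principal_angles (tangent_space A x) (tangent_space B x) - {0} \<subseteq> {\<theta>\<^sub>0..pi/2}"
    and "\<rho> > 0" and "reach A \<ge> ereal \<rho>" and "reach B \<ge> ereal \<rho>"
    and "second_fundamental_form_bounded A \<kappa>" and "second_fundamental_form_bounded B \<kappa>"
  shows "\<exists>r \<sigma>. 0 < r \<and> r \<le> \<rho> \<and> 0 < \<sigma> \<and>
    (\<forall>I x. is_interval I \<longrightarrow> rrr_solution A B I x \<longrightarrow>
       (\<forall>t\<in>I. x t \<in> rrr_tube A B r \<longrightarrow>
          (\<exists>d. ((\<lambda>s. 1/2 * (norm (rrr_field A B (x s)))\<^sup>2) has_real_derivative d) (at t within I) \<and>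
               d \<le> - \<sigma> * (norm (rrr_field A B (x t)))\<^sup>2))) \<and>
    (\<forall>x. rrr_solution A B {0..} x \<longrightarrow> (\<forall>t\<ge>0. x t \<in> rrr_tube A B r) \<longrightarrow>
       (\<forall>t\<ge>0. norm (rrr_field A B (x t)) \<le> exp (- \<sigma> * t) * norm (rrr_field A B (x 0))) \<and>
       ((\<lambda>t. infdist (x t) (A \<inter> B)) \<longlongrightarrow> 0) at_top)"
proof -
  let ?v = "rrr_field A B"
  define P where "P = (\<lambda>\<sigma> x. \<exists>D. (?v has_derivative D) (at x) \<and> ?v x \<bullet> D (?v x) \<le> - \<sigma> * (norm (?v x))\<^sup>2 \<and>
    \<sigma> * norm (x - closest_point A x) \<le> norm (?v x))"
  have "\<exists>\<sigma>>0. \<forall>\<^sub>F x in nhds p. P \<sigma> x" if "p \<in> A \<inter> B" for p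
    unfolding P_def using rrr_field_local_contraction[OF assms(5,1,13,6,2,14,12,7) that] .
  moreover have "P \<tau> x" if "P \<sigma> x" "0 < \<tau>" "\<tau> \<le> \<sigma>" for \<sigma> \<tau> x
  proof -
    have "- \<sigma> * (norm (?v x))\<^sup>2 \<le> - \<tau> * (norm (?v x))\<^sup>2"
      using that by (intro mult_right_mono) auto
    moreover have "\<tau> * norm (x - closest_point A x) \<le> \<sigma> * norm (x - closest_point A x)"
      using that by (intro mult_right_mono) auto
    ultimately show ?thesis
      using that(1) unfolding P_def by (meson order_trans)
  qed
  ultimately obtain \<sigma> \<delta> where \<sigma>: "\<sigma> > 0" and \<delta>: "\<delta> > 0"
    and P: "\<And>x m. \<lbrakk>m \<in> A \<inter> B; dist x m < \<delta>\<rbrakk> \<Longrightarrow> P \<sigma> x"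
    using compact_uniform_eventually[OF assms(8), of P] by metis
  note near = separated_at_infinity_near_intersection[OF assms(1,2,4,9)]
  obtain s where s: "s > 0" "\<And>a. \<lbrakk>a \<in> A; infdist a B \<le> s\<rbrakk> \<Longrightarrow> \<exists>m\<in>A \<inter> B. dist a m < \<delta> / 2"
    using near[of "\<delta> / 2"] \<delta> by auto
  \<comment> \<open>A point of the tube has its foot point within \<open>2 * r\<close> of
    \<open>B\<close>, which must not exceed \<open>s\<close>; the foot point is then within
    \<open>\<delta> / 2\<close> of the intersection, and the remaining \<open>\<delta> / 2\<close>
    covers the distance from \<open>x\<close> to it.\<close>
  define r where "r = min \<rho> (min (s / 2) (\<delta> / 2))"
  have r: "0 < r" "r \<le> \<rho>" "2 * r \<le> s" "2 * r \<le> \<delta>"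
    using assms(12) s \<delta> by (auto simp: r_def)
  have cpA: "closest_point A x \<in> A" and cpB: "closest_point B x \<in> B" for x
    using assms by (auto intro: closest_point_in_set)
  have tube: "P \<sigma> x" if "x \<in> rrr_tube A B r" for x
  proof -
    let ?a = "closest_point A x"
    have xa: "dist x ?a \<le> r" and rB: "infdist (reflection A x) B \<le> r"
      using that assms by (auto simp: rrr_tube_def dist_closest_point_eq_infdist)
    \<comment> \<open>The foot point is the midpoint of \<open>x\<close> and its reflection.\<close>
    have "dist ?a (reflection A x) = dist x ?a"
      by (simp add: reflection_def dist_norm scaleR_2 norm_minus_commute algebra_simps)
    then have "infdist ?a B \<le> s"
      using infdist_triangle[of ?a B "reflection A x"] xa rB r by linarith
    then obtain m where m: "m \<in> A \<inter> B" "dist ?a m < \<delta> / 2"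
      using s(2) cpA by blast
    then have "dist x m < \<delta>"
      using dist_triangle[of x m ?a] xa r by linarith
    with m show ?thesis
      using P by blast
  qed
  have deriv: "\<exists>d. ((\<lambda>s. 1/2 * (norm (?v (x s)))\<^sup>2) has_real_derivative d) (at t within I) \<and>
      d \<le> - \<sigma> * (norm (?v (x t)))\<^sup>2"
    if sol: "rrr_solution A B I x" and t: "t \<in> I" and tb: "x t \<in> rrr_tube A B r" for I x t
  proof -
    obtain D where D: "(?v has_derivative D) (at (x t))" "?v (x t) \<bullet> D (?v (x t)) \<le> - \<sigma> * (norm (?v (x t)))\<^sup>2"
      using tube[OF tb] by (auto simp: P_def)
    have "(x has_derivative (\<lambda>h. h *\<^sub>R ?v (x t))) (at t within I)"
      using sol t by (simp add: rrr_solution_def has_vector_derivative_def)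
    from has_derivative_compose[OF this D(1)]
    have d: "((\<lambda>s. ?v (x s)) has_derivative (\<lambda>h. D (h *\<^sub>R ?v (x t)))) (at t within I)" .
    \<comment> \<open>The velocity of the solution is the field itself, so the chain rule produces
      the quadratic expression bounded in \<open>P\<close>.\<close>
    have "((\<lambda>s. 1/2 * (?v (x s) \<bullet> ?v (x s))) has_real_derivative ?v (x t) \<bullet> D (?v (x t))) (at t within I)"
      unfolding has_field_derivative_def
      by (rule has_derivative_eq_rhs[OF has_derivative_mult_right[OF has_derivative_inner[OF d d]]])
        (simp add: fun_eq_iff linear_scale[OF has_derivative_linear[OF D(1)]] inner_commute)
    with D(2) show ?thesis
      by (auto simp: power2_norm_eq_inner)
  qed
  have decay: "norm (?v (x t)) \<le> exp (- \<sigma> * t) * norm (?v (x 0))"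
    if sol: "rrr_solution A B {0..} x" and tb: "\<forall>t\<ge>0. x t \<in> rrr_tube A B r" and t: "t \<ge> 0" for x t
  proof -
    let ?f = "\<lambda>s. 1/2 * (norm (?v (x s)))\<^sup>2"
    \<comment> \<open>The halved squared norm decays at rate \<open>2 * \<sigma>\<close>; the square
      root brings the rate back to \<sigma>.\<close>
    have "\<exists>d. (?f has_real_derivative d) (at u within {0..}) \<and> d \<le> - (2 * \<sigma>) * ?f u" if "u \<ge> 0" for u
      using deriv[OF sol, of u] tb that by auto
    then obtain f' where "\<And>u. u \<ge> 0 \<Longrightarrow> (?f has_real_derivative f' u) (at u within {0..}) \<and> f' u \<le> - (2 * \<sigma>) * ?f u"
      by metis
    then have "?f t \<le> exp (- (2 * \<sigma>) * t) * ?f 0"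
      using t by (intro exponential_decay[of ?f f']) auto
    then have "(norm (?v (x t)))\<^sup>2 \<le> (exp (- \<sigma> * t) * norm (?v (x 0)))\<^sup>2"
      by (simp add: power_mult_distrib mult.assoc flip: exp_double)
    then show ?thesis
      by (rule power2_le_imp_le) simp
  qed
  have lim: "((\<lambda>t. infdist (x t) (A \<inter> B)) \<longlongrightarrow> 0) at_top"
    if sol: "rrr_solution A B {0..} x" and tb: "\<forall>t\<ge>0. x t \<in> rrr_tube A B r" for x
  proof (rule tendstoI)
    fix e :: real assume e: "e > 0"
    \<comment> \<open>Separation is applied again at the scale \<open>e / 2\<close>: the field
      bounds the distance of the foot point from \<open>B\<close>, hence eventually brings it within
      \<open>e / 2\<close> of the intersection, and by \<open>P\<close> it also bounds the distance
      from \<open>x t\<close> to the foot point.\<close>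
    obtain u where u: "u > 0" "\<And>a. \<lbrakk>a \<in> A; infdist a B \<le> u\<rbrakk> \<Longrightarrow> \<exists>m\<in>A \<inter> B. dist a m < e / 2"
      using near[of "e / 2"] e by auto
    have "((\<lambda>t. exp (- \<sigma> * t) * norm (?v (x 0))) \<longlongrightarrow> 0) at_top"
      using \<sigma> by real_asymp
    moreover have "0 < min u (\<sigma> * (e / 2))"
      using u e \<sigma> by simp
    ultimately have "\<forall>\<^sub>F t in at_top. exp (- \<sigma> * t) * norm (?v (x 0)) < min u (\<sigma> * (e / 2))"
      by (rule order_tendstoD(2))
    with eventually_ge_at_top[of 0] show "\<forall>\<^sub>F t in at_top. dist (infdist (x t) (A \<inter> B)) 0 < e"
    proof eventually_elim
      case (elim t)
      let ?a = "closest_point A (x t)"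
      have v: "norm (?v (x t)) < min u (\<sigma> * (e / 2))"
        using decay[OF sol tb] elim by fastforce
      have "infdist ?a B \<le> dist ?a (closest_point B (reflection A (x t)))"
        by (rule infdist_le[OF cpB])
      also have "\<dots> = norm (?v (x t))"
        by (simp add: rrr_field_def dist_norm norm_minus_commute)
      finally obtain m where m: "m \<in> A \<inter> B" "dist ?a m < e / 2"
        using u(2)[OF cpA] v by force
      have "\<sigma> * norm (x t - ?a) < \<sigma> * (e / 2)"
        using tube[of "x t"] tb elim v by (auto simp: P_def)
      then have "dist (x t) ?a < e / 2"
        using \<sigma> by (simp add: dist_norm)
      then have "infdist (x t) (A \<inter> B) < e"
        using infdist_le[OF m(1), of "x t"] dist_triangle[of "x t" m ?a] m(2) by linarith
      then show ?case
        by (simp add: infdist_nonneg)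
    qed
  qed
  show ?thesis
    using r \<sigma> deriv decay lim by (intro exI[of _ r] exI[of _ \<sigma>]) blast
qed

end
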